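(* Let $(X,\mathcal{B},\mu,f)$ be a dissipative measurable system with $\mu$ a purely atomic measure, and assume that $f$ is ergodic. Let $p\ge 1$ be a real number and let $T_f:L^p(X)\to L^p(X)$, $T_f\varphi=\varphi\circ f$, be the associated composition operator. Then the following statements are equivalent: (a) $T_f$ is frequently hypercyclic; (b) $T_f$ is chaotic; (c) $\mu$ is finite, i.e. $\mu(X)<\infty$.
   Context: A measurable system is a tuple $(X,\mathcal{B},\mu,f)$ where: $(X,\mathcal{B},\mu)$ is a $\sigma$-finite measure space with $\mu(X)>0$; $f:X\to X$ is bijective, bimeasurable ($f(B),f^{-1}(B)\in\mathcal{B}$ for all $B\in\mathcal{B}$) and nonsingular ($\mu(f^{-1}(B))=0$ if and only if $\mu(B)=0$); and there is $c>0$ with $\mu(f^{-1}(B))\le c\,\mu(B)$ for all $B\in\mathcal{B}$. The last condition makes $T_f$ a continuous linear operator on $L^p(X)$. The system is dissipative if there is $W\in\mathcal{B}$ such that the sets $f^n(W)$, $n\in\mathbb{Z}$, are pairwise disjoint and $X=\bigcup_{n\in\mathbb{Z}}f^n(W)$. The map $f$ is ergodic if every $A\in\mathcal{B}$ with $f^{-1}(A)=A$ satisfies $\mu(A)=0$ or $\mu(X\setminus A)=0$. Let $T$ be a continuous linear operator on a Banach space $\mathcal{H}$. $T$ is topologically transitive if for all non-empty open $U,V\subseteq\mathcal{H}$ there is $k>0$ with $T^k(U)\cap V\ne\emptyset$; $T$ is chaotic if it is topologically transitive and its periodic points are dense in $\mathcal{H}$; $T$ is frequently hypercyclic if there is $\varphi\in\mathcal{H}$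 such that for every non-empty open $U\subseteq\mathcal{H}$, $\liminf_{N\to\infty}\frac1N\#\{1\le n\le N: T^n\varphi\in U\}>0$. *)

theory Defs
  imports "HOL-Analysis.Analysis"
begin

section \<open>Measurable systems\<close>

text \<open>
  The underlying set \<open>X\<close> is \<^term>\<open>space M\<close>; nothing is assumed about \<open>f\<close> outside of it, so
  preimages are always cut down to \<^term>\<open>space M\<close>.
\<close>

locale measurable_system = sigma_finite_measure M for M :: "'a measure" +
  fixes f :: "'a \<Rightarrow> 'a"
  assumes space_pos: "emeasure M (space M) > 0"
    and bij: "bij_betw f (space M) (space M)"
    and image_sets: "\<And>B. B \<in> sets M \<Longrightarrow> f ` B \<in> sets M"
    and preimage_sets: "\<And>B. B \<in> sets M \<Longrightarrow> f -` B \<inter> space M \<in> sets M"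
    and nonsingular: "\<And>B. B \<in> sets M \<Longrightarrow>
      emeasure M (f -` B \<inter> space M) = 0 \<longleftrightarrow> emeasure M B = 0"
    and bounded: "\<exists>c::real. c > 0 \<and>
      (\<forall>B\<in>sets M. emeasure M (f -` B \<inter> space M) \<le> ennreal c * emeasure M B)"

text \<open>\<open>f\<^sup>n(W)\<close> for \<open>n \<in> \<int>\<close>; for negative \<open>n\<close> this is the preimage under \<open>f\<^sup>-\<^sup>n\<close>, as \<open>f\<close> is bijective.\<close>

definition int_iterate :: "'a measure \<Rightarrow> ('a \<Rightarrow> 'a) \<Rightarrow> int \<Rightarrow> 'a set \<Rightarrow> 'a set" where
  "int_iterate M f n W =
     (if n \<ge> 0 then (f ^^ nat n) ` W else (f ^^ nat (- n)) -` W \<inter> space M)"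

definition dissipative :: "'a measure \<Rightarrow> ('a \<Rightarrow> 'a) \<Rightarrow> bool" where
  "dissipative M f \<longleftrightarrow>
     (\<exists>W\<in>sets M. disjoint_family (\<lambda>n::int. int_iterate M f n W) \<and>
        space M = (\<Union>n::int. int_iterate M f n W))"

definition ergodic :: "'a measure \<Rightarrow> ('a \<Rightarrow> 'a) \<Rightarrow> bool" where
  "ergodic M f \<longleftrightarrow>
     (\<forall>A\<in>sets M. f -` A \<inter> space M = A \<longrightarrow>
        emeasure M A = 0 \<or> emeasure M (space M - A) = 0)"

definition atom :: "'a measure \<Rightarrow> 'a set \<Rightarrow> bool" where
  "atom M A \<longleftrightarrow> A \<in> sets M \<and> emeasure M A > 0 \<and>
     (\<forall>B\<in>sets M. B \<subseteq> A \<longrightarrow> emeasure M B = 0 \<or> emeasure M (A - B) = 0)"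

definition purely_atomic :: "'a measure \<Rightarrow> bool" where
  "purely_atomic M \<longleftrightarrow>
     (\<forall>B\<in>sets M. emeasure M B > 0 \<longrightarrow> (\<exists>A. A \<subseteq> B \<and> atom M A))"


section \<open>Linear dynamics\<close>

definition topologically_transitive :: "'b topology \<Rightarrow> ('b \<Rightarrow> 'b) \<Rightarrow> bool" where
  "topologically_transitive H T \<longleftrightarrow>
     (\<forall>U V. openin H U \<and> U \<noteq> {} \<and> openin H V \<and> V \<noteq> {} \<longrightarrow>
        (\<exists>k>0. (T ^^ k) ` U \<inter> V \<noteq> {}))"

definition periodic_points :: "'b topology \<Rightarrow> ('b \<Rightarrow> 'b) \<Rightarrow> 'b set" where
  "periodic_points H T = {x \<in> topspace H. \<exists>n>0. (T ^^ n) x = x}"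

definition chaotic :: "'b topology \<Rightarrow> ('b \<Rightarrow> 'b) \<Rightarrow> bool" where
  "chaotic H T \<longleftrightarrow>
     topologically_transitive H T \<and> H closure_of (periodic_points H T) = topspace H"

definition frequently_hypercyclic :: "'b topology \<Rightarrow> ('b \<Rightarrow> 'b) \<Rightarrow> bool" where
  "frequently_hypercyclic H T \<longleftrightarrow>
     (\<exists>x\<in>topspace H. \<forall>U. openin H U \<and> U \<noteq> {} \<longrightarrow>
        liminf (\<lambda>N. ereal (real (card {n\<in>{1..N}. (T ^^ n) x \<in> U}) / real N)) > 0)"


section \<open>The space $L^p$ and composition operators\<close>

text \<open>
  Elements of $L^p$ are classes of functions modulo equality almost everywhere. The scalars are any
  type of sort \<open>{real_normed_field, banach, second_countable_topology}\<close>; the instances are, up to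
  isomorphism, exactly the real and the complex numbers (a complete field with multiplicative norm
  over the reals), so both the real and the complex spaces are covered.
\<close>

definition Lp_fun ::
    "'a measure \<Rightarrow> real \<Rightarrow> ('a \<Rightarrow> 'k::{real_normed_field, banach, second_countable_topology}) set" where
  "Lp_fun M p = {\<phi> \<in> borel_measurable M. integrable M (\<lambda>x. norm (\<phi> x) powr p)}"

definition Lp_rel ::
    "'a measure \<Rightarrow> real \<Rightarrow> ('a \<Rightarrow> 'k::{real_normed_field, banach, second_countable_topology}) rel" where
  "Lp_rel M p = {(\<phi>, \<psi>). \<phi> \<in> Lp_fun M p \<and> \<psi> \<in> Lp_fun M p \<and> (AE x in M. \<phi> x = \<psi> x)}"

definition Lp_space ::
    "'a measure \<Rightarrow> real \<Rightarrow> ('a \<Rightarrow> 'k::{real_normed_field, banach, second_countable_topology}) set set" where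
  "Lp_space M p = Lp_fun M p // Lp_rel M p"

definition Lp_norm ::
    "'a measure \<Rightarrow> real \<Rightarrow> ('a \<Rightarrow> 'k::{real_normed_field, banach, second_countable_topology}) \<Rightarrow> real" where
  "Lp_norm M p \<phi> = (LINT x|M. norm (\<phi> x) powr p) powr (1 / p)"

text \<open>The choice of representatives is immaterial, see \<open>Lp_dist_class\<close> below.\<close>

definition Lp_dist ::
    "'a measure \<Rightarrow> real \<Rightarrow> ('a \<Rightarrow> 'k::{real_normed_field, banach, second_countable_topology}) set \<Rightarrow>
      ('a \<Rightarrow> 'k) set \<Rightarrow> real" where
  "Lp_dist M p F G = Lp_norm M p (\<lambda>x. (SOME \<phi>. \<phi> \<in> F) x - (SOME \<psi>. \<psi> \<in> G) x)"

definition Lp_topology ::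
    "'a measure \<Rightarrow> real \<Rightarrow> ('a \<Rightarrow> 'k::{real_normed_field, banach, second_countable_topology}) set topology" where
  "Lp_topology M p = Metric_space.mtopology (Lp_space M p) (Lp_dist M p)"

text \<open>
  The class of \<open>\<phi>\<close> is sent to the class of \<open>\<phi> \<circ> f\<close>; the union is over classes that all coincide
  when \<open>f\<close> belongs to a measurable system, see \<open>composition_operator_class\<close> below.
\<close>

definition composition_operator ::
    "'a measure \<Rightarrow> real \<Rightarrow> ('a \<Rightarrow> 'a) \<Rightarrow>
      ('a \<Rightarrow> 'k::{real_normed_field, banach, second_countable_topology}) set \<Rightarrow> ('a \<Rightarrow> 'k) set" where
  "composition_operator M p f F = (\<Union>\<phi>\<in>F. Lp_rel M p `` {\<phi> \<circ> f})"


subsection \<open>Well-definedness\<close>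

lemma Lp_rel_equiv: "equiv (Lp_fun M p) (Lp_rel M p)"
proof (rule equivI)
  show "Lp_rel M p \<subseteq> Lp_fun M p \<times> Lp_fun M p"
    by (auto simp: Lp_rel_def)
  show "refl_on (Lp_fun M p) (Lp_rel M p)"
    by (auto simp: refl_on_def Lp_rel_def)
  show "sym (Lp_rel M p)"
    by (auto simp: sym_def Lp_rel_def elim: eventually_mono)
  show "trans (Lp_rel M p)"
    unfolding trans_def Lp_rel_def by auto
qed

lemma Lp_norm_cong_AE:
  assumes "\<phi> \<in> borel_measurable M" "\<psi> \<in> borel_measurable M" "AE x in M. \<phi> x = \<psi> x"
  shows "Lp_norm M p \<phi> = Lp_norm M p \<psi>"
proof -
  have "(LINT x|M. norm (\<phi> x) powr p) = (LINT x|M. norm (\<psi> x) powr p)"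
    using assms by (intro integral_cong_AE) auto
  then show ?thesis by (simp add: Lp_norm_def)
qed

lemma Lp_some:
  assumes "F \<in> Lp_space M p"
  shows "(SOME \<phi>. \<phi> \<in> F) \<in> F"
proof -
  have "F \<noteq> {}"
    using assms in_quotient_imp_non_empty[OF Lp_rel_equiv] unfolding Lp_space_def by blast
  then show ?thesis by (simp add: some_in_eq)
qed

lemma Lp_space_subset: "F \<in> Lp_space M p \<Longrightarrow> F \<subseteq> Lp_fun M p"
  unfolding Lp_space_def using in_quotient_imp_subset[OF Lp_rel_equiv] by blast

lemma Lp_space_AE: "F \<in> Lp_space M p \<Longrightarrow> \<phi> \<in> F \<Longrightarrow> \<psi> \<in> F \<Longrightarrow> AE x in M. \<phi> x = \<psi> x"
  unfolding Lp_space_def using in_quotient_imp_in_rel[OF Lp_rel_equiv, of F M p \<phi> \<psi>]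
  by (auto simp: Lp_rel_def)

lemma Lp_dist_class:
  assumes "F \<in> Lp_space M p" "G \<in> Lp_space M p" "\<phi> \<in> F" "\<psi> \<in> G"
  shows "Lp_dist M p F G = Lp_norm M p (\<lambda>x. \<phi> x - \<psi> x)"
proof -
  let ?a = "SOME \<phi>. \<phi> \<in> F" and ?b = "SOME \<psi>. \<psi> \<in> G"
  have ab: "?a \<in> F" "?b \<in> G" using assms Lp_some by auto
  have m: "\<phi> \<in> borel_measurable M" "\<psi> \<in> borel_measurable M"
      "?a \<in> borel_measurable M" "?b \<in> borel_measurable M"
    using ab assms Lp_space_subset[OF assms(1)] Lp_space_subset[OF assms(2)]
    by (auto simp: Lp_fun_def subset_iff)
  have "AE x in M. ?a x = \<phi> x" "AE x in M. ?b x = \<psi> x"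
    using Lp_space_AE assms ab by blast+
  then have "AE x in M. ?a x - ?b x = \<phi> x - \<psi> x" by auto
  then show ?thesis
    unfolding Lp_dist_def using m by (intro Lp_norm_cong_AE) auto
qed

lemma powr_convex_combination:
  fixes u v A B p :: real
  assumes p: "1 \<le> p" and uv: "0 \<le> u" "0 \<le> v" and AB: "0 < A" "0 < B"
  shows "(u + v) powr p \<le>
    (A + B) powr p * (A / (A + B) * (u powr p / A powr p) + B / (A + B) * (v powr p / B powr p))"
proof -
  have aux: "w powr p \<le> (C + D) powr p * (D / (C + D) * (w powr p / D powr p))"
    if "0 \<le> w" "0 < C" "0 < D" for w C D :: real
  proof -
    have "D powr (p - 1) \<le> (C + D) powr (p - 1)"
      using that p by (intro powr_mono2) auto
    then have "1 \<le> (C + D) powr (p - 1) / D powr (p - 1)"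
      using that by simp
    also have "\<dots> = (C + D) powr p * (D / (C + D) / D powr p)"
      using that by (simp add: powr_diff field_simps)
    finally have "w powr p * 1 \<le> w powr p * ((C + D) powr p * (D / (C + D) / D powr p))"
      by (intro mult_left_mono) auto
    then show ?thesis by (simp add: mult_ac)
  qed
  consider "u = 0" | "v = 0" | "0 < u" "0 < v" using uv by linarith
  then show ?thesis
  proof cases
    case 1
    then show ?thesis using aux[of v A B] assms by simp
  next
    case 2
    then show ?thesis using aux[of u B A] assms by (simp add: add.commute)
  next
    case 3
    define t where "t = B / (A + B)"
    have t: "0 \<le> t" "t \<le> 1" "1 - t = A / (A + B)"
      using AB by (auto simp: t_def field_simps)
    have "((1 - t) *\<^sub>R (u / A) + t *\<^sub>R (v / B)) powr p \<le>
        (1 - t) * (u / A) powr p + t * (v / B) powr p"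
      using 3 AB t by (intro convex_onD[OF powr_convex[OF p]]) auto
    moreover have "(1 - t) *\<^sub>R (u / A) + t *\<^sub>R (v / B) = (u + v) / (A + B)"
      unfolding t(3) unfolding t_def using AB by (simp add: add_divide_distrib)
    ultimately have "((u + v) / (A + B)) powr p \<le>
        A / (A + B) * (u powr p / A powr p) + B / (A + B) * (v powr p / B powr p)"
      unfolding t(3) unfolding t_def using 3 AB by (simp add: powr_divide)
    moreover have "((u + v) / (A + B)) powr p = (u + v) powr p / (A + B) powr p"
      using 3 AB by (simp add: powr_divide)
    ultimately show ?thesis
      using AB by (simp add: pos_divide_le_eq mult.commute)
  qed
qed

lemma Lp_fun_add:
  assumes p: "1 \<le> p" and f: "f \<in> Lp_fun M p" and g: "g \<in> Lp_fun M p"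
  shows "(\<lambda>x. f x + g x) \<in> Lp_fun M p"
proof -
  have m: "f \<in> borel_measurable M" "g \<in> borel_measurable M"
    using f g by (auto simp: Lp_fun_def)
  have "integrable M (\<lambda>x. norm (f x + g x) powr p)"
  proof (rule Bochner_Integration.integrable_bound)
    show "integrable M (\<lambda>x. 2 powr p * (1/2 * (norm (f x) powr p) + 1/2 * (norm (g x) powr p)))"
      using f g by (auto simp: Lp_fun_def)
    show "AE x in M. norm (norm (f x + g x) powr p)
        \<le> norm (2 powr p * (1/2 * (norm (f x) powr p) + 1/2 * (norm (g x) powr p)))"
    proof (rule AE_I2)
      fix x
      have "norm (f x + g x) powr p \<le> (norm (f x) + norm (g x)) powr p"
        using p by (intro powr_mono2) (auto simp: norm_triangle_ineq)
      also have "\<dots> \<le> 2 powr p * (1/2 * (norm (f x) powr p) + 1/2 * (norm (g x) powr p))"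
        using powr_convex_combination[OF p, of "norm (f x)" "norm (g x)" 1 1] by simp
      finally show "norm (norm (f x + g x) powr p)
          \<le> norm (2 powr p * (1/2 * (norm (f x) powr p) + 1/2 * (norm (g x) powr p)))"
        by simp
    qed
  qed (use m in auto)
  then show ?thesis using m by (auto simp: Lp_fun_def)
qed

lemma Lp_fun_diff:
  assumes p: "1 \<le> p" and f: "f \<in> Lp_fun M p" and g: "g \<in> Lp_fun M p"
  shows "(\<lambda>x. f x - g x) \<in> Lp_fun M p"
proof -
  have "(\<lambda>x. - g x) \<in> Lp_fun M p"
    using g by (auto simp: Lp_fun_def)
  from Lp_fun_add[OF p f this] show ?thesis by simp
qed

lemma Lp_norm_nonneg: "0 \<le> Lp_norm M p f"
  by (simp add: Lp_norm_def)

lemma Lp_norm_powr: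
  assumes "1 \<le> p"
  shows "Lp_norm M p f powr p = (LINT x|M. norm (f x) powr p)"
proof -
  have "0 \<le> (LINT x|M. norm (f x) powr p)" by simp
  then show ?thesis using assms by (simp add: Lp_norm_def powr_powr)
qed

lemma Lp_norm_triangle:
  assumes p: "1 \<le> p" and f: "f \<in> Lp_fun M p" and g: "g \<in> Lp_fun M p"
  shows "Lp_norm M p (\<lambda>x. f x + g x) \<le> Lp_norm M p f + Lp_norm M p g"
proof (rule field_le_epsilon)
  fix e :: real assume e: "0 < e"
  define A where "A = Lp_norm M p f + e / 2"
  define B where "B = Lp_norm M p g + e / 2"
  have AB: "0 < A" "0 < B"
    using e Lp_norm_nonneg[of M p f] Lp_norm_nonneg[of M p g] by (auto simp: A_def B_def)
  have If: "integrable M (\<lambda>x. norm (f x) powr p)" and Ig: "integrable M (\<lambda>x. norm (g x) powr p)"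
    and Ifg: "integrable M (\<lambda>x. norm (f x + g x) powr p)"
    using f g Lp_fun_add[OF p f g] by (auto simp: Lp_fun_def)
  have fA: "(LINT x|M. norm (f x) powr p) \<le> A powr p"
    unfolding Lp_norm_powr[OF p, symmetric]
    using p e Lp_norm_nonneg[of M p f] by (intro powr_mono2) (auto simp: A_def)
  have gB: "(LINT x|M. norm (g x) powr p) \<le> B powr p"
    unfolding Lp_norm_powr[OF p, symmetric]
    using p e Lp_norm_nonneg[of M p g] by (intro powr_mono2) (auto simp: B_def)
  have "(LINT x|M. norm (f x + g x) powr p) \<le>
      (LINT x|M. (A + B) powr p * (A / (A + B) * (norm (f x) powr p / A powr p)
         + B / (A + B) * (norm (g x) powr p / B powr p)))"
  proof (rule integral_mono)
    fix x
    have "norm (f x + g x) powr p \<le> (norm (f x) + norm (g x)) powr p"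
      using p by (intro powr_mono2) (auto simp: norm_triangle_ineq)
    also have "\<dots> \<le> (A + B) powr p * (A / (A + B) * (norm (f x) powr p / A powr p)
         + B / (A + B) * (norm (g x) powr p / B powr p))"
      using powr_convex_combination[OF p _ _ AB] by simp
    finally show "norm (f x + g x) powr p \<le> (A + B) powr p *
        (A / (A + B) * (norm (f x) powr p / A powr p)
         + B / (A + B) * (norm (g x) powr p / B powr p))" .
  qed (use If Ig Ifg in \<open>auto intro!: Bochner_Integration.integrable_add\<close>)
  also have "\<dots> = (A + B) powr p * (A / (A + B) * ((LINT x|M. norm (f x) powr p) / A powr p)
         + B / (A + B) * ((LINT x|M. norm (g x) powr p) / B powr p))"
    using If Ig by (subst integral_mult_right_zero, subst Bochner_Integration.integral_add) auto
  also have "\<dots> \<le> (A + B) powr p * (A / (A + B) * 1 + B / (A + B) * 1)"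
    using fA gB AB by (intro mult_left_mono add_mono) auto
  also have "A / (A + B) * 1 + B / (A + B) * 1 = 1"
    using AB by (simp add: add_divide_distrib[symmetric])
  finally have "Lp_norm M p (\<lambda>x. f x + g x) powr p \<le> (A + B) powr p"
    by (simp add: Lp_norm_powr[OF p])
  then have "Lp_norm M p (\<lambda>x. f x + g x) \<le> A + B"
    using p AB Lp_norm_nonneg[of M p "\<lambda>x. f x + g x"]
    by (meson add_pos_pos less_eq_real_def not_less powr_less_mono2 zero_less_one order_less_le_trans)
  then show "Lp_norm M p (\<lambda>x. f x + g x) \<le> Lp_norm M p f + Lp_norm M p g + e"
    by (simp add: A_def B_def)
qed

lemma Lp_norm_eq_0:
  assumes p: "1 \<le> p" and f: "f \<in> Lp_fun M p"
  shows "Lp_norm M p f = 0 \<longleftrightarrow> (AE x in M. f x = 0)"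
proof -
  have "Lp_norm M p f = 0 \<longleftrightarrow> (LINT x|M. norm (f x) powr p) = 0"
    by (simp add: Lp_norm_def)
  also have "\<dots> \<longleftrightarrow> (AE x in M. norm (f x) powr p = 0)"
    using f by (intro integral_nonneg_eq_0_iff_AE) (auto simp: Lp_fun_def)
  finally show ?thesis by simp
qed

lemma Lp_class_eqI:
  assumes "F \<in> Lp_space M p" "G \<in> Lp_space M p" "\<phi> \<in> F" "\<psi> \<in> G" "AE x in M. \<phi> x = \<psi> x"
  shows "F = G"
proof -
  have "(\<phi>, \<psi>) \<in> Lp_rel M p"
    using assms Lp_space_subset[OF assms(1)] Lp_space_subset[OF assms(2)] by (auto simp: Lp_rel_def)
  then show ?thesis
    using quotient_eqI[OF Lp_rel_equiv] assms unfolding Lp_space_def by blast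
qed

lemma Lp_Metric_space:
  assumes p: "1 \<le> p"
  shows "Metric_space (Lp_space M p) (Lp_dist M p)"
proof
  fix F G :: "('a \<Rightarrow> 'b) set"
  show "0 \<le> Lp_dist M p F G" by (simp add: Lp_dist_def Lp_norm_nonneg)
  show "Lp_dist M p F G = Lp_dist M p G F"
    by (simp add: Lp_dist_def Lp_norm_def norm_minus_commute)
next
  fix F G :: "('a \<Rightarrow> 'b) set"
  assume FG: "F \<in> Lp_space M p" "G \<in> Lp_space M p"
  obtain \<phi> \<psi> where r: "\<phi> \<in> F" "\<psi> \<in> G" using Lp_some FG by blast
  have m: "\<phi> \<in> Lp_fun M p" "\<psi> \<in> Lp_fun M p" using r FG Lp_space_subset by blast+
  have "Lp_dist M p F G = 0 \<longleftrightarrow> (AE x in M. \<phi> x - \<psi> x = 0)"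
    unfolding Lp_dist_class[OF FG r] by (rule Lp_norm_eq_0[OF p Lp_fun_diff[OF p m]])
  also have "\<dots> \<longleftrightarrow> (AE x in M. \<phi> x = \<psi> x)" by simp
  also have "\<dots> \<longleftrightarrow> F = G"
    using Lp_class_eqI[OF FG r] Lp_space_AE FG r by blast
  finally show "Lp_dist M p F G = 0 \<longleftrightarrow> F = G" .
next
  fix F G H :: "('a \<Rightarrow> 'b) set"
  assume FGH: "F \<in> Lp_space M p" "G \<in> Lp_space M p" "H \<in> Lp_space M p"
  obtain \<phi> \<psi> \<theta> where r: "\<phi> \<in> F" "\<psi> \<in> G" "\<theta> \<in> H" using Lp_some FGH by blast
  have m: "\<phi> \<in> Lp_fun M p" "\<psi> \<in> Lp_fun M p" "\<theta> \<in> Lp_fun M p"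
    using r FGH Lp_space_subset by blast+
  have "Lp_norm M p (\<lambda>x. (\<phi> x - \<psi> x) + (\<psi> x - \<theta> x))
      \<le> Lp_norm M p (\<lambda>x. \<phi> x - \<psi> x) + Lp_norm M p (\<lambda>x. \<psi> x - \<theta> x)"
    using m by (intro Lp_norm_triangle[OF p] Lp_fun_diff[OF p])
  then show "Lp_dist M p F H \<le> Lp_dist M p F G + Lp_dist M p G H"
    using FGH r by (simp add: Lp_dist_class)
qed

context measurable_system
begin

lemma measurable_f [measurable]: "f \<in> measurable M M"
  using bij preimage_sets by (auto simp: measurable_def bij_betw_def)

lemma Lp_fun_comp:
  assumes c: "c > 0" "\<And>B. B \<in> sets M \<Longrightarrow> emeasure M (f -` B \<inter> space M) \<le> ennreal c * emeasure M B"
    and \<phi>: "\<phi> \<in> Lp_fun M p"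
  shows "\<phi> \<circ> f \<in> Lp_fun M p"
    and "(LINT x|M. norm ((\<phi> \<circ> f) x) powr p) \<le> c * (LINT x|M. norm (\<phi> x) powr p)"
proof -
  have m [measurable]: "\<phi> \<in> borel_measurable M" and I: "integrable M (\<lambda>x. norm (\<phi> x) powr p)"
    using \<phi> by (auto simp: Lp_fun_def)
  let ?h = "\<lambda>x. ennreal (norm (\<phi> x) powr p)"
  have "(\<integral>\<^sup>+x. ?h (f x) \<partial>M) = (\<integral>\<^sup>+x. ?h x \<partial>distr M M f)"
    by (simp add: nn_integral_distr)
  also have "\<dots> \<le> (\<integral>\<^sup>+x. ?h x \<partial>scale_measure (ennreal c) M)"
    by (intro nn_integral_mono_measure) (auto simp: le_measure le_fun_def emeasure_distr c(2))
  also have "\<dots> = ennreal c * (\<integral>\<^sup>+x. ?h x \<partial>M)"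
    by (simp add: nn_integral_scale_measure)
  also have "\<dots> = ennreal (c * (LINT x|M. norm (\<phi> x) powr p))"
    using I c(1) by (simp add: nn_integral_eq_integral ennreal_mult)
  finally have le: "(\<integral>\<^sup>+x. ?h (f x) \<partial>M) \<le> ennreal (c * (LINT x|M. norm (\<phi> x) powr p))" .
  have I2: "integrable M (\<lambda>x. norm (\<phi> (f x)) powr p)"
    using le by (intro integrableI_nonneg) (auto simp: le_less_trans)
  then show "\<phi> \<circ> f \<in> Lp_fun M p" by (simp add: Lp_fun_def comp_def)
  show "(LINT x|M. norm ((\<phi> \<circ> f) x) powr p) \<le> c * (LINT x|M. norm (\<phi> x) powr p)"
    using le I2 c(1) by (simp add: nn_integral_eq_integral)
qed

lemma AE_comp:
  assumes "AE x in M. P x"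
  shows "AE x in M. P (f x)"
proof -
  from assms obtain N where N: "{x \<in> space M. \<not> P x} \<subseteq> N" "N \<in> null_sets M"
    by (auto simp: eventually_ae_filter)
  have "f -` N \<inter> space M \<in> null_sets M"
    using N nonsingular[of N] preimage_sets[of N] by (auto simp: null_sets_def)
  moreover have "{x \<in> space M. \<not> P (f x)} \<subseteq> f -` N \<inter> space M"
    using N(1) bij by (auto simp: bij_betw_def)
  ultimately show ?thesis unfolding eventually_ae_filter by blast
qed

lemma composition_operator_class:
  fixes F :: "('a \<Rightarrow> 'k::{real_normed_field, banach, second_countable_topology}) set"
  assumes F: "F \<in> Lp_space M p" and \<phi>: "\<phi> \<in> F"
  shows "composition_operator M p f F \<in> Lp_space M p" "\<phi> \<circ> f \<in> composition_operator M p f F"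
proof -
  obtain c where c: "c > 0" "\<And>B. B \<in> sets M \<Longrightarrow> emeasure M (f -` B \<inter> space M) \<le> ennreal c * emeasure M B"
    using bounded by auto
  have in_Lp: "\<psi> \<circ> f \<in> Lp_fun M p" if "\<psi> \<in> F" for \<psi>
    using Lp_fun_comp(1)[OF c, of \<psi> p] that Lp_space_subset[OF F] by blast
  have "Lp_rel M p `` {\<psi> \<circ> f} = Lp_rel M p `` {\<phi> \<circ> f}" if "\<psi> \<in> F" for \<psi>
  proof (rule equiv_class_eq[OF Lp_rel_equiv])
    show "(\<psi> \<circ> f, \<phi> \<circ> f) \<in> Lp_rel M p"
      using in_Lp that \<phi> AE_comp[OF Lp_space_AE[OF F that \<phi>]] by (simp add: Lp_rel_def)
  qed
  then have eq: "composition_operator M p f F = Lp_rel M p `` {\<phi> \<circ> f}"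
    unfolding composition_operator_def using \<phi> by blast
  show "composition_operator M p f F \<in> Lp_space M p"
    unfolding eq Lp_space_def using in_Lp[OF \<phi>] by (rule quotientI)
  show "\<phi> \<circ> f \<in> composition_operator M p f F"
    unfolding eq using in_Lp[OF \<phi>] by (rule equiv_class_self[OF Lp_rel_equiv])
qed

lemma continuous_composition_operator:
  assumes p: "1 \<le> p"
  shows "continuous_map (Lp_topology M p) (Lp_topology M p)
    (composition_operator M p f :: ('a \<Rightarrow> 'k::{real_normed_field, banach, second_countable_topology}) set \<Rightarrow> _)"
proof -
  interpret L: Metric_space "Lp_space M p :: ('a \<Rightarrow> 'k) set set" "Lp_dist M p"
    by (rule Lp_Metric_space[OF p])
  let ?m = "metric (Lp_space M p :: ('a \<Rightarrow> 'k) set set, Lp_dist M p)"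
  let ?T = "composition_operator M p f :: ('a \<Rightarrow> 'k) set \<Rightarrow> _"
  obtain c where c: "c > 0" "\<And>B. B \<in> sets M \<Longrightarrow> emeasure M (f -` B \<inter> space M) \<le> ennreal c * emeasure M B"
    using bounded by auto
  have "Lipschitz_continuous_map ?m ?m ?T"
    unfolding Lipschitz_continuous_map_def
  proof (intro conjI exI ballI)
    show "?T \<in> mspace ?m \<rightarrow> mspace ?m"
      using composition_operator_class(1) Lp_some by fastforce
    fix F G assume "F \<in> mspace ?m" "G \<in> mspace ?m"
    then have FG: "F \<in> Lp_space M p" "G \<in> Lp_space M p" by auto
    obtain \<phi> \<psi> where r: "\<phi> \<in> F" "\<psi> \<in> G" using Lp_some FG by blast
    define h where "h = (\<lambda>x. \<phi> x - \<psi> x)"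
    have h: "h \<in> Lp_fun M p"
      using r FG Lp_space_subset unfolding h_def by (intro Lp_fun_diff[OF p]) blast+
    have "Lp_dist M p (?T F) (?T G) = Lp_norm M p (h \<circ> f)"
      using Lp_dist_class[OF composition_operator_class(1)[OF FG(1) r(1)]
          composition_operator_class(1)[OF FG(2) r(2)]
          composition_operator_class(2)[OF FG(1) r(1)]
          composition_operator_class(2)[OF FG(2) r(2)]]
      by (simp add: h_def comp_def)
    also have "\<dots> \<le> (c * (LINT x|M. norm (h x) powr p)) powr (1 / p)"
      unfolding Lp_norm_def using Lp_fun_comp(2)[OF c h] p by (intro powr_mono2) auto
    also have "\<dots> = c powr (1 / p) * Lp_dist M p F G"
      using c by (simp add: Lp_dist_class[OF FG r] Lp_norm_def powr_mult h_def)
    finally show "mdist ?m (?T F) (?T G) \<le> c powr (1 / p) * mdist ?m F G" by simp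
  qed
  then have "continuous_map (mtopology_of ?m) (mtopology_of ?m) ?T"
    by (rule Lipschitz_continuous_imp_continuous_map)
  then show ?thesis by (simp add: Lp_topology_def)
qed

end

end

theory Submission
  imports Defs
begin

text \<open>
  By ergodicity the images \<open>f\<^sup>n(W)\<close> of the wandering set are atoms of finite masses \<open>a\<^sub>n\<close>, so functions are
  almost everywhere constant on them, and \<open>T\<^sub>f\<close> becomes the backward shift on the sequence space
  \<open>\<ell>\<^sup>p(\<int>, a)\<close>.

  Suppose a vector returns near the unit sequence \<open>e\<^sub>0\<close> at all times of a set \<open>A\<close> of positive lower
  density. Comparing the coordinates at two times of \<open>A\<close> bounds the sum of \<open>a\<^sub>m\<^sub>-\<^sub>n\<close> over \<open>m \<in> A\<close>,
  uniformly in \<open>n \<in> A\<close>. Averaging over \<open>n\<close>, and using that the frequent differences of \<open>A\<close> form a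
  syndetic set (the argument of Bayart and Ruzsa) and that \<open>a\<^sub>k\<^sub>-\<^sub>1 \<le> c a\<^sub>k\<close>, gives \<open>\<Sum> a\<^sub>k < \<infinity>\<close>. This covers
  frequent hypercyclicity, and also chaos, since a periodic vector near \<open>e\<^sub>0\<close> returns along the multiples of
  its period.

  If the measure is finite, every bounded sequence lies in the space, so truncated sequences can be
  continued periodically, and a frequently hypercyclic vector is obtained by writing copies of countably
  many finitely supported sequences at widely separated positions.
\<close>

section \<open>Differences of sets of positive density\<close>

text \<open>Bonferroni's inequality by induction: adding one set gains at least \<alpha> points and
  loses at most \<open>card K * \<beta>\<close> to overlaps. The square is a convenient upper bound
  for the number of pairs.\<close>

lemma card_UN_lower_bound:
  fixes S :: "'i \<Rightarrow> 'b set" and \<alpha> \<beta> :: real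
  assumes "finite K" "\<And>i. i \<in> K \<Longrightarrow> finite (S i)" "\<And>i. i \<in> K \<Longrightarrow> \<alpha> \<le> card (S i)"
    and "\<And>i j. i \<in> K \<Longrightarrow> j \<in> K \<Longrightarrow> i \<noteq> j \<Longrightarrow> card (S i \<inter> S j) \<le> \<beta>" "0 \<le> \<beta>"
  shows "card K * \<alpha> - (card K)\<^sup>2 * \<beta> \<le> card (\<Union>i\<in>K. S i)"
  using assms
proof (induction K rule: finite_induct)
  case empty
  then show ?case by simp
next
  case (insert x K)
  let ?U = "\<Union>i\<in>K. S i"
  have fin: "finite (S x)" "finite ?U" using insert.hyps(1) insert.prems(1) by auto
  have "card (S x \<inter> ?U) = card (\<Union>i\<in>K. S x \<inter> S i)" by (simp only: Int_UN_distrib)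
  also have "\<dots> \<le> (\<Sum>i\<in>K. card (S x \<inter> S i))" by (rule card_UN_le[OF insert(1)])
  finally have "real (card (S x \<inter> ?U)) \<le> (\<Sum>i\<in>K. real (card (S x \<inter> S i)))"
    by (metis of_nat_le_iff of_nat_sum)
  also have "\<dots> \<le> (\<Sum>i\<in>K. \<beta>)"
    using insert.hyps(2) by (intro sum_mono insert.prems(3)) auto
  finally have 1: "real (card (S x \<inter> ?U)) \<le> card K * \<beta>" by simp
  have 2: "card K * \<alpha> - (card K)\<^sup>2 * \<beta> \<le> card ?U"
    by (rule insert.IH) (use insert.prems in auto)
  have "card (S x) + card ?U = card (S x \<union> ?U) + card (S x \<inter> ?U)"
    by (rule card_Un_Int[OF fin])
  then have 3: "real (card (S x)) + real (card ?U) = real (card (S x \<union> ?U)) + real (card (S x \<inter> ?U))"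
    by (metis of_nat_add)
  have 4: "\<alpha> \<le> card (S x)" using insert.prems(2) by auto
  have "(card (insert x K))\<^sup>2 * \<beta> = (card K)\<^sup>2 * \<beta> + 2 * (card K * \<beta>) + \<beta>"
    using insert(1,2) by (simp add: power2_eq_square algebra_simps)
  moreover have "card (insert x K) * \<alpha> = card K * \<alpha> + \<alpha>"
    using insert(1,2) by (simp add: algebra_simps)
  moreover have "0 \<le> card K * \<beta>" using insert.prems(4) by simp
  ultimately have "card (insert x K) * \<alpha> - (card (insert x K))\<^sup>2 * \<beta> \<le> card (S x \<union> ?U)"
    using 1 2 3 4 insert.prems(4) by linarith
  then show ?case by simp
qed

text \<open>An autocorrelation of \<open>A\<close>: both \<open>n\<close> and \<open>n + k\<close>
  must lie in the window, which makes the count symmetric in \<open>k\<close>.\<close>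

definition return_count :: "int set \<Rightarrow> nat \<Rightarrow> int \<Rightarrow> nat" where
  "return_count A N k = card {n \<in> A \<inter> {1..int N}. n + k \<in> A \<inter> {1..int N}}"

lemma return_count_minus: "return_count A N (- k) = return_count A N k"
proof -
  have "{n \<in> A \<inter> {1..int N}. n + - k \<in> A \<inter> {1..int N}}
      = (\<lambda>n. n + k) ` {n \<in> A \<inter> {1..int N}. n + k \<in> A \<inter> {1..int N}}" (is "?S = _ ` ?R")
  proof
    show "?S \<subseteq> (\<lambda>n. n + k) ` ?R"
    proof
      fix n assume "n \<in> ?S"
      then show "n \<in> (\<lambda>n. n + k) ` ?R" by (intro image_eqI[of _ _ "n - k"]) auto
    qed
  qed auto
  then show ?thesis
    unfolding return_count_def by (simp add: card_image inj_on_def)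
qed

text \<open>Double counting of the pairs \<open>(n, n + k)\<close>: exchanging the sums leaves, for
  each of at most \<open>N\<close> points \<open>n\<close>, a sum of \<open>a (m - n)\<close> over
  points \<open>m\<close> of \<open>A\<close>.\<close>

lemma sum_return_count:
  fixes a :: "int \<Rightarrow> real"
  assumes a: "\<And>k. 0 \<le> a k" and "finite I" and C: "0 \<le> C"
    and sum: "\<And>n F. n \<in> A \<Longrightarrow> finite F \<Longrightarrow> F \<subseteq> A \<Longrightarrow> (\<Sum>m\<in>F. a (m - n)) \<le> C"
  shows "(\<Sum>k\<in>I. a k * return_count A N k) \<le> C * N"
proof -
  let ?A = "A \<inter> {1..int N}"
  have "(\<Sum>k\<in>I. a k * return_count A N k) = (\<Sum>k\<in>I. \<Sum>n\<in>?A. if n + k \<in> ?A then a k else 0)"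
  proof (rule sum.cong[OF refl])
    fix k
    have "(\<Sum>n\<in>?A. if n + k \<in> ?A then a k else 0) = (\<Sum>n\<in>{n \<in> ?A. n + k \<in> ?A}. a k)"
      by (rule sum.inter_filter[symmetric]) simp
    then show "a k * return_count A N k = (\<Sum>n\<in>?A. if n + k \<in> ?A then a k else 0)"
      by (simp add: return_count_def mult.commute)
  qed
  also have "\<dots> = (\<Sum>n\<in>?A. \<Sum>k\<in>I. if n + k \<in> ?A then a k else 0)" by (rule sum.swap)
  also have "\<dots> \<le> (\<Sum>n\<in>?A. C)"
  proof (rule sum_mono)
    fix n assume n: "n \<in> ?A"
    have "(\<Sum>k\<in>I. if n + k \<in> ?A then a k else 0) = (\<Sum>k\<in>{k \<in> I. n + k \<in> ?A}. a k)"
      by (rule sum.inter_filter[symmetric]) fact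
    also have "\<dots> = (\<Sum>m\<in>(\<lambda>k. n + k) ` {k \<in> I. n + k \<in> ?A}. a (m - n))"
      by (subst sum.reindex) (auto simp: inj_on_def)
    also have "\<dots> \<le> C" using n \<open>finite I\<close> by (intro sum) auto
    finally show "(\<Sum>k\<in>I. if n + k \<in> ?A then a k else 0) \<le> C" .
  qed
  also have "\<dots> = C * card ?A" by simp
  also have "\<dots> \<le> C * N"
  proof -
    have "card ?A \<le> card {1..int N}" by (rule card_mono) auto
    then show ?thesis using C by (intro mult_left_mono) auto
  qed
  finally show ?thesis .
qed

text \<open>
  The translates of \<open>A \<inter> {1..N}\<close> by a set \<open>K\<close> of shifts with pairwise few common points are almost
  disjoint, which bounds the size of \<open>K\<close>; a set \<open>K\<close> of maximal size then has the stated property.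
\<close>

lemma syndetic_returns:
  fixes A :: "int set"
  assumes \<delta>: "0 < \<delta>" and dens: "\<forall>\<^sub>F N in sequentially. \<delta> * real N \<le> card (A \<inter> {1..int N})"
  obtains \<eta> :: real and K :: "int set" where "0 < \<eta>" "finite K"
    "\<And>J. finite J \<Longrightarrow> \<exists>\<^sub>F N in sequentially. \<forall>k\<in>J. \<exists>i\<in>K. \<eta> * real N \<le> return_count A N (k - i)"
proof -
  \<comment> \<open>With \<open>R * \<delta> \<ge> 4\<close> and
    \<open>\<eta> = \<delta> / (4 * R)\<close>, the union of \<open>R\<close> separated translates
    would have at least \<open>3 * N\<close> points, too many for a window of at most
    \<open>2 * N\<close>.\<close>
  define R where "R = nat \<lceil>4 / \<delta>\<rceil>"
  have R: "4 / \<delta> \<le> R" unfolding R_def by linarith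
  then have R4: "4 \<le> R * \<delta>" using \<delta> by (simp add: field_simps)
  have Rpos: "0 < R" using R4 \<delta> by (cases "R = 0") auto
  define \<eta> where "\<eta> = \<delta> / (4 * R)"
  have \<eta>: "0 < \<eta>" "\<eta> \<le> \<delta>" using \<delta> Rpos by (auto simp: \<eta>_def field_simps)
  define sep where "sep K N \<longleftrightarrow> (\<forall>i\<in>K. \<forall>j\<in>K. i \<noteq> j \<longrightarrow> return_count A N (i - j) < \<eta> * real N)"
    for K :: "int set" and N
  define P where "P r \<longleftrightarrow> (\<exists>K. finite K \<and> card K = r \<and> (\<exists>\<^sub>F N in sequentially. sep K N))" for r
  have bound: "r < R" if "P r" for r
  proof (rule ccontr)
    assume "\<not> r < R"
    from that obtain K0 where K0: "finite K0" "card K0 = r" "\<exists>\<^sub>F N in sequentially. sep K0 N"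
      by (auto simp: P_def)
    obtain K where K: "K \<subseteq> K0" "card K = R" "finite K"
      using obtain_subset_with_card_n[of R K0] K0 \<open>\<not> r < R\<close> by auto
    \<comment> \<open>Once \<open>2 * M < N\<close>, translates by at most \<open>M\<close> stay in
      an interval of fewer than \<open>2 * N\<close> points.\<close>
    define M where "M = nat (Max ((\<lambda>k. \<bar>k\<bar>) ` K))"
    have M: "\<bar>k\<bar> \<le> int M" if "k \<in> K" for k
    proof -
    have "\<bar>k\<bar> \<le> Max ((\<lambda>k. \<bar>k\<bar>) ` K)" by (rule Max_ge) (use that K in auto)
    then show ?thesis unfolding M_def by linarith
  qed
    have "\<forall>\<^sub>F N in sequentially. \<delta> * real N \<le> card (A \<inter> {1..int N}) \<and> 2 * M < N"
      by (rule eventually_conj[OF dens eventually_gt_at_top])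
    from frequently_ex[OF frequently_eventually_conj[OF K0(3) this]]
    obtain N where N: "sep K0 N" "\<delta> * real N \<le> card (A \<inter> {1..int N})" "2 * M < N" by blast
    define S where "S i = (\<lambda>n. n + i) ` (A \<inter> {1..int N})" for i
    have "card K * (\<delta> * N) - (card K)\<^sup>2 * (\<eta> * N) \<le> card (\<Union>i\<in>K. S i)"
    proof (rule card_UN_lower_bound)
      show "\<delta> * N \<le> card (S i)" for i
        unfolding S_def by (subst card_image) (auto simp: inj_on_def N(2))
      fix i j assume ij: "i \<in> K" "j \<in> K" "i \<noteq> j"
      have "real (card (S i \<inter> S j)) \<le> real (return_count A N (i - j))"
        unfolding return_count_def of_nat_le_iff
      proof (rule card_inj_on_le[where f = "\<lambda>n. n - i"])
        show "(\<lambda>n. n - i) ` (S i \<inter> S j)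
            \<subseteq> {n \<in> A \<inter> {1..int N}. n + (i - j) \<in> A \<inter> {1..int N}}"
        proof clarify
          fix n assume "n \<in> S i" "n \<in> S j"
          then obtain u v where "u \<in> A \<inter> {1..int N}" "n = u + i" "v \<in> A \<inter> {1..int N}" "n = v + j"
            unfolding S_def by blast
          moreover from this have "n - i = u" "n - i + (i - j) = v" by simp_all
          ultimately show "n - i \<in> A \<inter> {1..int N} \<and> n - i + (i - j) \<in> A \<inter> {1..int N}"
            by (simp only:)
        qed
      qed (auto simp: inj_on_def intro: finite_subset[of _ "{1..int N}"])
      also have "\<dots> < \<eta> * N" using N(1) ij K(1) by (auto simp: sep_def)
      finally show "card (S i \<inter> S j) \<le> \<eta> * N" by simp
    qed (use K \<eta> in \<open>auto simp: S_def\<close>)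
    also have "card (\<Union>i\<in>K. S i) \<le> card {1 - int M..int N + int M}"
      by (rule card_mono) (use M in \<open>fastforce simp: S_def\<close>)+
    also have "\<dots> \<le> 2 * N" using N(3) by simp
    finally have "R * (\<delta> * N) - R\<^sup>2 * (\<eta> * N) \<le> 2 * N" using K(2) by simp
    moreover have "R * (\<delta> * N) - R\<^sup>2 * (\<eta> * N) = 3 / 4 * (R * \<delta>) * N"
      using Rpos by (simp add: \<eta>_def power2_eq_square field_simps)
    moreover have "3 / 4 * (R * \<delta>) * N \<ge> 3 * real N"
      by (rule mult_right_mono) (use R4 in linarith, simp)
    moreover have "0 < real N" using N(3) by simp
    ultimately show False by linarith
  qed
  have "sep {} = (\<lambda>_. True)" by (simp add: sep_def fun_eq_iff)
  then have "P 0" unfolding P_def by (intro exI[of _ "{}"]) simp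
  then have "P (GREATEST r. P r)"
    by (rule GreatestI_nat[where b = R]) (use bound in \<open>auto intro: less_imp_le\<close>)
  then obtain K where K: "finite K" "card K = (GREATEST r. P r)" "\<exists>\<^sub>F N in sequentially. sep K N"
    by (auto simp: P_def)
  have maximal: "\<not> P (Suc (card K))"
  proof
    assume "P (Suc (card K))"
    then have "Suc (card K) \<le> (GREATEST r. P r)"
      by (rule Greatest_le_nat[where b = R]) (use bound in \<open>auto intro: less_imp_le\<close>)
    then show False using K(2) by simp
  qed
  \<comment> \<open>A shift already in \<open>K\<close> returns by the density itself, since \<eta>
    \<le> \<delta>. A new one destroys the separation for all large \<open>N\<close> by maximality,
    so it has many returns relative to some member of \<open>K\<close>, in one of two directions
    that symmetry identifies.\<close>
  have ev: "\<forall>\<^sub>F N in sequentially. sep K N \<longrightarrow> (\<exists>i\<in>K. \<eta> * real N \<le> return_count A N (k - i))" for k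
  proof (cases "k \<in> K")
    case True
    show ?thesis using dens
    proof eventually_elim
      case (elim N)
      have "\<eta> * N \<le> \<delta> * N" using \<eta> by (intro mult_right_mono) auto
      also have "\<dots> \<le> return_count A N (k - k)" using elim by (simp add: return_count_def Int_def)
      finally show ?case using True by blast
    qed
  next
    case False
    then have "\<not> (\<exists>\<^sub>F N in sequentially. sep (insert k K) N)"
      using maximal K(1) unfolding P_def by (metis card_insert_disjoint finite_insert)
    then have "\<forall>\<^sub>F N in sequentially. \<not> sep (insert k K) N"
      by (simp add: not_frequently)
    then show ?thesis
    proof eventually_elim
      case (elim N)
      show ?case
      proof
        assume "sep K N"
        with elim obtain i where "i \<in> K"
            "\<eta> * real N \<le> return_count A N (k - i) \<or> \<eta> * real N \<le> return_count A N (i - k)"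
          unfolding sep_def by (auto simp: not_less)
        then show "\<exists>i\<in>K. \<eta> * real N \<le> return_count A N (k - i)"
          using return_count_minus[of A N "k - i"] by auto
      qed
    qed
  qed
  have "\<exists>\<^sub>F N in sequentially. \<forall>k\<in>J. \<exists>i\<in>K. \<eta> * real N \<le> return_count A N (k - i)" if "finite J" for J
  proof -
    have "\<forall>\<^sub>F N in sequentially. \<forall>k\<in>J. sep K N \<longrightarrow> (\<exists>i\<in>K. \<eta> * real N \<le> return_count A N (k - i))"
      by (rule eventually_ball_finite[OF that]) (use ev in blast)
    from frequently_eventually_conj[OF K(3) this] show ?thesis
      by (rule frequently_elim1) auto
  qed
  with \<eta>(1) K(1) that show thesis by blast
qed

text \<open>For infinitely many \<open>N\<close>, all members of a given finite set are frequent
  differences up to shifts from \<open>K\<close>, and the growth condition pays for a shift with a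
  constant factor. A frequent difference is counted at least \<open>\<eta> * N\<close> times, so the
  double counting bound can be divided by this.\<close>

lemma bounded_sums_of_dense_returns:
  fixes a :: "int \<Rightarrow> real" and A :: "int set"
  assumes a: "\<And>k. 0 \<le> a k" and c: "1 \<le> c" "\<And>k. a (k - 1) \<le> c * a k"
    and \<delta>: "0 < \<delta>" "\<forall>\<^sub>F N in sequentially. \<delta> * real N \<le> card (A \<inter> {1..int N})"
    and C: "0 \<le> C" "\<And>n F. n \<in> A \<Longrightarrow> finite F \<Longrightarrow> F \<subseteq> A \<Longrightarrow> (\<Sum>m\<in>F. a (m - n)) \<le> C"
  shows "\<exists>B. \<forall>J. finite J \<longrightarrow> (\<Sum>k\<in>J. a k) \<le> B"
proof -
  obtain \<eta> :: real and K where \<eta>: "0 < \<eta>" and K: "finite K" and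
    ret: "\<And>J. finite J \<Longrightarrow> \<exists>\<^sub>F N in sequentially. \<forall>k\<in>J. \<exists>i\<in>K. \<eta> * real N \<le> return_count A N (k - i)"
    using syndetic_returns[OF \<delta>] by blast
  define H where "H = nat (Max ((\<lambda>k. \<bar>k\<bar>) ` K))"
  have H: "\<bar>k\<bar> \<le> int H" if "k \<in> K" for k
  proof -
    have "\<bar>k\<bar> \<le> Max ((\<lambda>k. \<bar>k\<bar>) ` K)" by (rule Max_ge) (use that K in auto)
    then show ?thesis unfolding H_def by linarith
  qed
  have step: "a (k - int n) \<le> c ^ n * a k" for k n
  proof (induction n)
    case (Suc n)
    have "a (k - int (Suc n)) \<le> c * a (k - int n)"
      using c(2)[of "k - int n"] by (simp add: algebra_simps)
    also have "\<dots> \<le> c * (c ^ n * a k)" using Suc c(1) by (intro mult_left_mono) auto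
    finally show ?case by simp
  qed simp
  \<comment> \<open>Adding \<open>H\<close> makes \<open>int H - i\<close> nonnegative, the
    direction in which the growth condition compares terms; it is at most
    \<open>2 * H\<close>.\<close>
  have up: "a k \<le> c ^ (2 * H) * a (k + int H - i)" if "i \<in> K" for i k
  proof -
    have "a k \<le> c ^ nat (int H - i) * a (k + int H - i)"
    proof -
      have "k + int H - i - int (nat (int H - i)) = k" using H[OF that] by linarith
      then show ?thesis using step[of "k + int H - i" "nat (int H - i)"] by (simp only:)
    qed
    also have "\<dots> \<le> c ^ (2 * H) * a (k + int H - i)"
      using H[OF that] c(1) a by (intro mult_right_mono power_increasing) auto
    finally show ?thesis .
  qed
  have "(\<Sum>k\<in>J. a k) \<le> c ^ (2 * H) * (card K * C) / \<eta>" if J: "finite J" for J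
  proof -
    \<comment> \<open>The returns are taken for the translated set, so that the differences met are
      exactly \<open>k + int H - i\<close>.\<close>
    have "finite ((\<lambda>k. k + int H) ` J)" using J by simp
    note frequently_eventually_conj[OF ret[OF this] eventually_gt_at_top[of 0]]
    from frequently_ex[OF this]
    obtain N where N: "\<And>k. k \<in> J \<Longrightarrow> \<exists>i\<in>K. \<eta> * real N \<le> return_count A N (k + int H - i)" "0 < N"
      by blast
    have "(\<Sum>k\<in>J. a k) * (\<eta> * N) = (\<Sum>k\<in>J. a k * (\<eta> * N))" by (simp add: sum_distrib_right)
    \<comment> \<open>The member \<open>i\<close> depends on \<open>k\<close>, so the sum runs over
      all of \<open>K\<close>; this costs the factor \<open>card K\<close>.\<close>
    also have "\<dots> \<le> (\<Sum>k\<in>J. \<Sum>i\<in>K. c ^ (2 * H) * (a (k + int H - i) * return_count A N (k + int H - i)))"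
    proof (rule sum_mono)
      fix k assume "k \<in> J"
      then obtain i where i: "i \<in> K" "\<eta> * real N \<le> return_count A N (k + int H - i)" using N by blast
      have "a k * (\<eta> * N) \<le> (c ^ (2 * H) * a (k + int H - i)) * return_count A N (k + int H - i)"
        using up[OF i(1)] i(2) a c \<eta> by (intro mult_mono) auto
      also have "\<dots> \<le> (\<Sum>i\<in>K. c ^ (2 * H) * (a (k + int H - i) * return_count A N (k + int H - i)))"
        unfolding mult.assoc by (rule member_le_sum[OF i(1)]) (use K a c in auto)
      finally show "a k * (\<eta> * N) \<le> (\<Sum>i\<in>K. c ^ (2 * H) * (a (k + int H - i) * return_count A N (k + int H - i)))" .
    qed
    also have "\<dots> = c ^ (2 * H) * (\<Sum>i\<in>K. \<Sum>k\<in>J. a (k + int H - i) * return_count A N (k + int H - i))"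
      by (subst sum.swap) (simp add: sum_distrib_left)
    also have "\<dots> \<le> c ^ (2 * H) * (\<Sum>i\<in>K. C * N)"
    proof (intro mult_left_mono sum_mono)
      fix i
      have "(\<Sum>k\<in>J. a (k + int H - i) * return_count A N (k + int H - i))
          = (\<Sum>k\<in>(\<lambda>k. k + int H - i) ` J. a k * return_count A N k)"
        by (subst sum.reindex) (auto simp: inj_on_def)
      also have "\<dots> \<le> C * N" by (rule sum_return_count[OF a _ C]) (use J in auto)
      finally show "(\<Sum>k\<in>J. a (k + int H - i) * return_count A N (k + int H - i)) \<le> C * N" .
    qed (use c in auto)
    also have "\<dots> = c ^ (2 * H) * (card K * C) * N" by simp
    finally have "(\<Sum>k\<in>J. a k) * \<eta> * N \<le> c ^ (2 * H) * (card K * C) * N" by (simp add: mult.assoc)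
    then have "(\<Sum>k\<in>J. a k) * \<eta> \<le> c ^ (2 * H) * (card K * C)" using N(2) by simp
    then show ?thesis using \<eta> by (simp add: field_simps)
  qed
  then show ?thesis by blast
qed

section \<open>Separated positions of positive density\<close>

text \<open>The first \<open>N div E\<close> values of \<open>g\<close> lie in
  \<open>{1..N}\<close>, and \<open>N div E\<close> is at least \<open>N / (2 * E)\<close> once
  \<open>N \<ge> E\<close>.\<close>

lemma linear_growth_density:
  assumes inj: "inj g" and P: "\<And>t. P (g t)"
    and g: "\<And>t::nat. 1 \<le> g t \<and> g t \<le> E * Suc t" and E: "0 < E"
  shows "\<exists>\<delta>>0. \<forall>\<^sub>F N in sequentially. \<delta> * real N \<le> card {n \<in> {1..N}. P n}"
proof -
  have "1 / (2 * E) * real N \<le> card {n \<in> {1..N}. P n}" if "E \<le> N" for N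
  proof -
    have "g ` {..<N div E} \<subseteq> {n \<in> {1..N}. P n}"
    proof (rule image_subsetI)
      fix t assume "t \<in> {..<N div E}"
      then have "E * Suc t \<le> E * (N div E)" by (intro mult_le_mono) auto
      also have "\<dots> \<le> N" by simp
      finally show "g t \<in> {n \<in> {1..N}. P n}" using g[of t] P by simp
    qed
    then have "card (g ` {..<N div E}) \<le> card {n \<in> {1..N}. P n}"
      by (intro card_mono) auto
    then have 1: "N div E \<le> card {n \<in> {1..N}. P n}"
      using inj by (simp add: card_image inj_on_subset)
    have "1 \<le> N div E" using that E by (simp add: less_eq_div_iff_mult_less_eq)
    have "N < E * (N div E) + E" using E by (metis add.commute dividend_less_times_div mult.commute)
    also have "\<dots> \<le> 2 * E * (N div E)" using \<open>1 \<le> N div E\<close> by simp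
    finally have "real N \<le> real (2 * E * (N div E))" by (simp only: of_nat_le_iff less_imp_le)
    then have "1 / (2 * E) * real N \<le> real (N div E)" using E by (simp add: field_simps)
    with 1 show ?thesis by linarith
  qed
  then have "\<forall>\<^sub>F N in sequentially. 1 / (2 * E) * real N \<le> card {n \<in> {1..N}. P n}"
    by (rule eventually_mono[OF eventually_ge_at_top[of E]])
  moreover have "0 < 1 / real (2 * E)" using E by simp
  ultimately show ?thesis by blast
qed

text \<open>
  The label \<open>j\<close> requires divisibility by a modulus \<open>m j \<ge> 2\<^sup>j * L j\<close>, so long gaps are so rare that
  the average gap stays bounded and every label keeps positive density.
\<close>

lemma marker_positions:
  fixes L :: "nat \<Rightarrow> nat"
  assumes L: "\<And>j. 1 \<le> L j"
  obtains pos lab :: "nat \<Rightarrow> nat" where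
    "\<And>q q'. q < q' \<Longrightarrow> pos q + L (lab q) + L (lab q') \<le> pos q'"
    "\<And>q. L (lab q) \<le> pos q"
    "\<And>j. \<exists>\<delta>>0. \<forall>\<^sub>F N in sequentially.
        \<delta> * real N \<le> card {n \<in> {1..N}. \<exists>q. n = pos q \<and> lab q = j}"
proof -
  define m where "m = rec_nat (1::nat) (\<lambda>j m. m * (2 ^ Suc j * L (Suc j)))"
  have m0: "m 0 = 1" and mS: "m (Suc j) = m j * (2 ^ Suc j * L (Suc j))" for j
    by (simp_all add: m_def)
  have mpos: "0 < m j" for j
    by (induction j) (use L in \<open>auto simp: m0 mS Suc_le_eq\<close>)
  have m_ge: "2 ^ Suc j * L (Suc j) \<le> m (Suc j)" for j
    unfolding mS using mpos[of j] by simp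
  have m_gt: "j < m j" for j
  proof (cases j)
    case (Suc i)
    have "j < 2 ^ j" by (rule less_exp)
    also have "\<dots> \<le> 2 ^ Suc i * L (Suc i)" using L[of "Suc i"] Suc by simp
    also have "\<dots> \<le> m j" using m_ge Suc by simp
    finally show ?thesis .
  qed (simp add: m0)
  have m_dvd: "m i dvd m j" if "i \<le> j" for i j
    using that by (induction rule: dec_induct) (auto simp: mS intro: dvd_trans)
  have m_less: "m j < m (Suc j)" for j
  proof -
    have "2 * 1 \<le> 2 ^ Suc j * L (Suc j)" by (rule mult_le_mono[OF _ L]) simp
    then show ?thesis unfolding mS using mpos[of j] by (simp only: n_less_n_mult_m)
  qed
  \<comment> \<open>Since the moduli form a divisibility chain, this is the largest \<open>j\<close>
    with \<open>m j\<close> dividing \<open>Suc q\<close>. It exists because \<open>m j > j\<close>;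
    the successor avoids 0, which every modulus divides.\<close>
  define lab where "lab q = (LEAST j. \<not> m (Suc j) dvd Suc q)" for q
  \<comment> \<open>Every earlier marker takes up its radius on both sides, the current one only on
    the left.\<close>
  define pos where "pos q = L (lab q) + 2 * (\<Sum>i<q. L (lab i))" for q
  have lab_ex: "\<not> m (Suc q) dvd Suc q" for q
    using m_gt[of "Suc q"] by (auto dest: dvd_imp_le)
  have lab_le: "lab q \<le> q" for q unfolding lab_def by (rule Least_le) (rule lab_ex)
  have lab_dvd: "m (lab q) dvd Suc q" for q
  proof (cases "lab q")
    case (Suc j)
    then have "j < (LEAST j. \<not> m (Suc j) dvd Suc q)" by (simp add: lab_def)
    from not_less_Least[OF this] show ?thesis using Suc by simp
  qed (simp add: m0)
  have sep: "pos q + L (lab q) + L (lab q') \<le> pos q'" if "q < q'" for q q'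
  proof -
    have "(\<Sum>i<Suc q. L (lab i)) \<le> (\<Sum>i<q'. L (lab i))"
      using that by (intro sum_mono2) auto
    then show ?thesis by (simp add: pos_def)
  qed
  \<comment> \<open>The average radius is charged \<open>L 0\<close> for label 0 and
    \<open>(1/2) ^ j\<close> for each label \<open>j \<ge> 1\<close>, because at most
    \<open>Q / m j\<close> of the first \<open>Q\<close> markers carry it.\<close>
  define D where "D = L 0 + 1"
  have avg: "(\<Sum>i<Q. L (lab i)) \<le> D * Q" for Q
  proof -
    have "(\<Sum>i<Q. real (L (lab i)))
        \<le> (\<Sum>i<Q. L 0 + (\<Sum>j\<in>{1..Q}. if m j dvd Suc i then real (L j) else 0))"
    proof (rule sum_mono)
      fix i assume i: "i \<in> {..<Q}"
      show "real (L (lab i)) \<le> L 0 + (\<Sum>j\<in>{1..Q}. if m j dvd Suc i then real (L j) else 0)"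
      proof (cases "lab i = 0")
        case False
        have "real (L (lab i)) = (if m (lab i) dvd Suc i then real (L (lab i)) else 0)"
          using lab_dvd by simp
        also have "\<dots> \<le> (\<Sum>j\<in>{1..Q}. if m j dvd Suc i then real (L j) else 0)"
          by (rule member_le_sum[where i = "lab i"]) (use False i lab_le[of i] in auto)
        finally show ?thesis by simp
      qed (auto intro: sum_nonneg)
    qed
    also have "\<dots> = L 0 * Q + (\<Sum>i<Q. \<Sum>j\<in>{1..Q}. if m j dvd Suc i then real (L j) else 0)"
      by (simp add: sum.distrib)
    also have "(\<Sum>i<Q. \<Sum>j\<in>{1..Q}. if m j dvd Suc i then real (L j) else 0)
        = (\<Sum>j\<in>{1..Q}. \<Sum>i<Q. if m j dvd Suc i then real (L j) else 0)" by (rule sum.swap)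
    also have "\<dots> \<le> (\<Sum>j\<in>{1..Q}. (1/2) ^ j * Q)"
    proof (rule sum_mono)
      fix j assume "j \<in> {1..Q}"
      then obtain j' where j': "j = Suc j'" by (cases j) auto
      have "{i \<in> {..<Q}. m j dvd Suc i} \<subseteq> (\<lambda>t. t * m j - 1) ` {1..Q div m j}"
      proof
        fix i assume "i \<in> {i \<in> {..<Q}. m j dvd Suc i}"
        then obtain t where t: "Suc i = m j * t" "i < Q" by auto
        have "t \<le> Q div m j" using t mpos[of j] by (simp add: less_eq_div_iff_mult_less_eq mult.commute)
        moreover have "1 \<le> t" using t(1) by (cases t) auto
        moreover have "i = t * m j - 1" using t(1) by (simp add: mult.commute)
        ultimately show "i \<in> (\<lambda>t. t * m j - 1) ` {1..Q div m j}" by auto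
      qed
      then have "card {i \<in> {..<Q}. m j dvd Suc i} \<le> card {1..Q div m j}"
        by (meson surj_card_le finite_atLeastAtMost)
      then have "real (card {i \<in> {..<Q}. m j dvd Suc i}) \<le> real (Q div m j)" by simp
      also have "\<dots> \<le> Q / m j" by (rule of_nat_div_le_of_nat)
      finally have 1: "real (card {i \<in> {..<Q}. m j dvd Suc i}) \<le> Q / m j" .
      have "real (2 ^ j * L j) \<le> real (m j)" using m_ge[of j'] unfolding j' of_nat_le_iff .
      then have 2: "L j / m j \<le> (1/2) ^ j" using mpos[of j] by (simp add: field_simps power_divide)
      have "(\<Sum>i<Q. if m j dvd Suc i then real (L j) else 0) = card {i \<in> {..<Q}. m j dvd Suc i} * real (L j)"
        by (subst sum.inter_filter[symmetric]) auto
      also have "\<dots> \<le> Q / m j * real (L j)" using 1 by (rule mult_right_mono) simp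
      also have "\<dots> = L j / m j * Q" by simp
      also have "\<dots> \<le> (1/2) ^ j * Q" using 2 by (rule mult_right_mono) simp
      finally show "(\<Sum>i<Q. if m j dvd Suc i then real (L j) else 0) \<le> (1/2) ^ j * Q" .
    qed
    also have "\<dots> = (\<Sum>j\<in>{1..Q}. (1/2) ^ j) * Q" by (simp add: sum_distrib_right)
    also have "\<dots> \<le> 1 * real Q"
    proof (rule mult_right_mono)
      have "(\<Sum>j\<in>{1..Q}. (1/2::real) ^ j) = 1 - (1/2) ^ Q" by (induction Q) auto
      then show "(\<Sum>j\<in>{1..Q}. (1/2::real) ^ j) \<le> 1" by simp
    qed simp
    finally have "(\<Sum>i<Q. real (L (lab i))) \<le> L 0 * Q + 1 * Q" by simp
    also have "\<dots> = real (D * Q)" by (simp add: D_def algebra_simps)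
    finally show ?thesis by (metis of_nat_le_iff of_nat_sum)
  qed
  have pos_le: "pos q \<le> 2 * D * Suc q" for q
    using avg[of "Suc q"] by (simp add: pos_def)
  have pos_inj: "inj pos"
  proof (rule strict_mono_imp_inj_on, rule strict_monoI)
    fix q q' :: nat assume "q < q'"
    from sep[OF this] L[of "lab q"] show "pos q < pos q'" by simp
  qed
  have dens: "\<exists>\<delta>>0. \<forall>\<^sub>F N in sequentially.
      \<delta> * real N \<le> card {n \<in> {1..N}. \<exists>q. n = pos q \<and> lab q = j}" for j
  proof -
    define E where "E = 2 * D * m (Suc j)"
    have E: "0 < E" using mpos by (simp add: E_def D_def)
    \<comment> \<open>Along this progression \<open>Suc (q t)\<close> is congruent to
      \<open>m j\<close> modulo \<open>m (Suc j)\<close>, which forces the label \<open>j\<close>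
      exactly. One progression already gives positive density.\<close>
    define q where "q t = m j + t * m (Suc j) - 1" for t
    have q: "Suc (q t) = m j + t * m (Suc j)" for t using mpos[of j] by (simp add: q_def)
    have lab_q: "lab (q t) = j" for t
      unfolding lab_def
    proof (rule Least_equality)
      have "\<not> m (Suc j) dvd m j" using m_less[of j] mpos[of j] by (auto dest: dvd_imp_le)
      then show "\<not> m (Suc j) dvd Suc (q t)" unfolding q by (simp add: dvd_add_left_iff)
      fix i assume "\<not> m (Suc i) dvd Suc (q t)"
      then show "j \<le> i" unfolding q using m_dvd[of "Suc i" j] m_dvd[of "Suc i" "Suc j"]
        by (metis Suc_leI dvd_add dvd_mult le_Suc_eq linorder_not_less)
    qed
    have pos_q: "pos (q t) \<le> E * Suc t" for t
    proof -
      have "pos (q t) \<le> 2 * D * (m j + t * m (Suc j))" using pos_le[of "q t"] unfolding q .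
      also have "\<dots> \<le> 2 * D * (m (Suc j) + t * m (Suc j))"
        using m_less[of j] by (intro mult_le_mono add_mono) auto
      finally show ?thesis by (simp add: E_def algebra_simps)
    qed
    have "q t \<noteq> q t'" if "t \<noteq> t'" for t t'
    proof
      assume "q t = q t'"
      then have "m j + t * m (Suc j) = m j + t' * m (Suc j)" by (metis q)
      then show False using that mpos[of "Suc j"] by simp
    qed
    then have inj: "inj (\<lambda>t. pos (q t))" using pos_inj by (auto simp: inj_def)
    show ?thesis
    proof (rule linear_growth_density[OF inj _ _ \<open>0 < E\<close>])
      fix t
      show "\<exists>q'. pos (q t) = pos q' \<and> lab q' = j" using lab_q by blast
      show "1 \<le> pos (q t) \<and> pos (q t) \<le> E * Suc t"
        using pos_q[of t] L[of "lab (q t)"] by (simp add: pos_def)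
    qed
  qed
  show thesis by (rule that[of pos lab]) (use sep dens in \<open>auto simp: pos_def\<close>)
qed

section \<open>Ergodic dissipative systems as towers of atoms\<close>

text \<open>For a wandering set \<open>W\<close>, \<open>idx x\<close> is the \<open>n\<close> for
  which \<open>x\<close> lies in the \<open>n\<close>-th iterate of \<open>W\<close>. It serves as
  the time coordinate that turns composition with \<open>f\<close> into a shift.\<close>

locale atomic_tower = measurable_system M f for M :: "'a measure" and f :: "'a \<Rightarrow> 'a" +
  fixes idx :: "'a \<Rightarrow> int"
  assumes idx_measurable [measurable]: "idx \<in> measurable M (count_space UNIV)"
    and idx_f: "\<And>x. x \<in> space M \<Longrightarrow> idx (f x) = idx x + 1"
    and level_atom: "\<And>k. atom M {x \<in> space M. idx x = k}"

context measurable_system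
begin

lemma funpow_space: "x \<in> space M \<Longrightarrow> (f ^^ n) x \<in> space M"
  using bij by (induction n) (auto simp: bij_betw_def)

lemma funpow_measurable [measurable]: "f ^^ n \<in> measurable M M"
  by (induction n) (auto simp: comp_def)

lemma funpow_image_sets: "B \<in> sets M \<Longrightarrow> (f ^^ n) ` B \<in> sets M"
proof (induction n)
  case (Suc n)
  then show ?case using image_sets[of "(f ^^ n) ` B"] by (simp add: image_comp)
qed simp

lemma int_iterate_sets: "B \<in> sets M \<Longrightarrow> int_iterate M f n B \<in> sets M"
  unfolding int_iterate_def
  using funpow_image_sets measurable_sets[OF funpow_measurable] by simp

text \<open>For \<open>n \<ge> 0\<close> injectivity of \<open>f\<close> cancels an image against a
  preimage; for negative \<open>n\<close> one more preimage is taken. Later arguments use this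
  recurrence in place of the case split in \<open>int_iterate\<close>.\<close>

lemma vimage_int_iterate:
  assumes "B \<subseteq> space M"
  shows "f -` int_iterate M f (n + 1) B \<inter> space M = int_iterate M f n B"
proof (cases "0 \<le> n")
  case True
  then have n: "nat (n + 1) = Suc (nat n)" by simp
  have "f -` (f ` S) \<inter> space M = S" if "S \<subseteq> space M" for S
    using that bij by (auto simp: bij_betw_def inj_on_def)
  moreover have "(f ^^ nat n) ` B \<subseteq> space M" using assms funpow_space by blast
  ultimately have "f -` (f ` (f ^^ nat n) ` B) \<inter> space M = (f ^^ nat n) ` B" by blast
  then show ?thesis using True by (simp add: int_iterate_def n image_comp)
next
  case False
  then have n: "nat (- n) = Suc (nat (- (n + 1)))" by simp
  \<comment> \<open>At \<open>n = - 1\<close> the left side falls under the image branch with zero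
    iterations; it agrees with the preimage because \<open>B\<close> lies in the space.\<close>
  have img: "int_iterate M f (n + 1) B = (f ^^ nat (- (n + 1))) -` B \<inter> space M"
    using assms False by (cases "n = - 1") (auto simp: int_iterate_def)
  have "f x \<in> space M" if "x \<in> space M" for x using funpow_space[OF that, of 1] by simp
  then show ?thesis
    using False unfolding img by (auto simp: int_iterate_def n funpow_Suc_right simp del: funpow.simps)
qed

text \<open>A measurable part \<open>B\<close> of one level generates an invariant union of
  iterates, which meets that level only in \<open>B\<close>. Ergodicity makes the union null or
  conull, hence \<open>B\<close> null or conull in its level. By nonsingularity one null level would
  make all levels null, which \<open>space_pos\<close> excludes.\<close>

lemma ergodic_dissipative_tower:
  assumes "dissipative M f" "ergodic M f"
  shows "\<exists>idx. atomic_tower M f idx"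
proof -
  obtain W where W: "W \<in> sets M" and disj: "disjoint_family (\<lambda>n::int. int_iterate M f n W)"
    and cover: "space M = (\<Union>n::int. int_iterate M f n W)"
    using assms(1) unfolding dissipative_def by blast
  have W_space: "W \<subseteq> space M" using W sets.sets_into_space by blast
  have ex1: "\<exists>!n. x \<in> int_iterate M f n W" if "x \<in> space M" for x
  proof (rule ex_ex1I)
    show "\<exists>n. x \<in> int_iterate M f n W" using that cover by blast
    show "n = m" if "x \<in> int_iterate M f n W" "x \<in> int_iterate M f m W" for n m
      using that disj by (auto simp: disjoint_family_on_def)
  qed
  define idx where "idx x = (THE n. x \<in> int_iterate M f n W)" for x
  have idx_eq: "idx x = n \<longleftrightarrow> x \<in> int_iterate M f n W" if "x \<in> space M" for x n
    unfolding idx_def using theI'[OF ex1[OF that]] the1_equality[OF ex1[OF that]] by blast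
  have it_space: "int_iterate M f n W \<subseteq> space M" for n using cover by blast
  have level: "{x \<in> space M. idx x = n} = int_iterate M f n W" for n
    using idx_eq it_space by blast
  have idx_f: "idx (f x) = idx x + 1" if "x \<in> space M" for x
  proof -
    have "x \<in> int_iterate M f (idx x) W" using idx_eq[OF that] by blast
    then have "f x \<in> int_iterate M f (idx x + 1) W" using vimage_int_iterate[OF W_space] by blast
    then show ?thesis using idx_eq it_space by blast
  qed
  have idx_funpow: "idx ((f ^^ n) x) = idx x + int n" if "x \<in> space M" for x n
    by (induction n) (use that idx_f funpow_space in auto)
  have sets_level: "{x \<in> space M. idx x = n} \<in> sets M" for n
    unfolding level by (rule int_iterate_sets[OF W])
  have zero_one: "emeasure M B = 0 \<or> emeasure M ({x \<in> space M. idx x = n} - B) = 0"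
    if B: "B \<in> sets M" "B \<subseteq> {x \<in> space M. idx x = n}" for B n
  proof -
    define A where "A = (\<Union>m. int_iterate M f m B)"
    have B_space: "B \<subseteq> space M" using B by blast
    have A: "A \<in> sets M" unfolding A_def using int_iterate_sets[OF B(1)] by auto
    have "f -` A \<inter> space M = (\<Union>m. f -` int_iterate M f m B \<inter> space M)"
      unfolding A_def by blast
    also have "\<dots> = (\<Union>m. f -` int_iterate M f (m + 1) B \<inter> space M)"
    proof -
      have "range (\<lambda>m::int. m + 1) = UNIV" using surj_plus_right by simp
      then have "(\<Union>m. S m) = (\<Union>m::int. S (m + 1))" for S :: "int \<Rightarrow> 'a set"
        by (metis image_image)
      then show ?thesis .
    qed
    also have "\<dots> = A" unfolding A_def by (simp only: vimage_int_iterate[OF B_space])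
    finally consider "emeasure M A = 0" | "emeasure M (space M - A) = 0"
      using assms(2) A unfolding ergodic_def by blast
    then show ?thesis
    proof cases
      case 1
      have "B \<subseteq> int_iterate M f 0 B" by (simp add: int_iterate_def)
      then have "B \<subseteq> A" unfolding A_def by blast
      then show ?thesis using 1 A emeasure_mono[of B A M] by simp
    next
      case 2
      have "{x \<in> space M. idx x = n} - B \<subseteq> space M - A"
      proof clarify
        fix x assume x: "x \<in> space M" "n = idx x" "x \<notin> B" "x \<in> A"
        then obtain m where m: "x \<in> int_iterate M f m B" unfolding A_def by blast
        have idx_B: "idx y = idx x" if "y \<in> B" for y using B that x(2) by blast
        \<comment> \<open>Each application of \<open>f\<close> raises \<open>idx\<close> by one, so
          an iterate of \<open>B\<close> that reaches the level of \<open>B\<close> is the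
          zeroth.\<close>
        have "m = 0"
        proof (cases "0 \<le> m")
          case True
          then obtain y where "y \<in> B" "x = (f ^^ nat m) y" using m by (auto simp: int_iterate_def)
          then show ?thesis using idx_funpow[of y "nat m"] idx_B[of y] B_space True by auto
        next
          case False
          then have "(f ^^ nat (- m)) x \<in> B" using m by (auto simp: int_iterate_def)
          then show ?thesis using idx_funpow[OF x(1), of "nat (- m)"] idx_B False by fastforce
        qed
        then show False using m x(3) by (simp add: int_iterate_def)
      qed
      then have "emeasure M ({x \<in> space M. idx x = n} - B) \<le> emeasure M (space M - A)"
        using A by (intro emeasure_mono) auto
      then show ?thesis using 2 by simp
    qed
  qed
  have step: "emeasure M {x \<in> space M. idx x = n} = 0 \<longleftrightarrow> emeasure M {x \<in> space M. idx x = n + 1} = 0" for n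
    using nonsingular[OF sets_level[of "n + 1"]] unfolding level vimage_int_iterate[OF W_space] by blast
  have pos: "0 < emeasure M {x \<in> space M. idx x = n}" for n
  proof (rule ccontr)
    assume "\<not> ?thesis"
    then have n: "emeasure M {x \<in> space M. idx x = n} = 0" by simp
    have "emeasure M {x \<in> space M. idx x = m} = 0" for m
    proof (induction m rule: int_induct[where k = n])
      case (step2 i)
      then show ?case using step[of "i - 1"] by simp
    qed (use n step in auto)
    then have "(\<Union>m::int. {x \<in> space M. idx x = m}) \<in> null_sets M"
      using sets_level by (intro null_sets_UN) auto
    moreover have "(\<Union>m::int. {x \<in> space M. idx x = m}) = space M" by blast
    ultimately have "emeasure M (space M) = 0" by (simp add: null_sets_def)
    then show False using space_pos by simp
  qed
  have "atomic_tower M f idx"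
  proof unfold_locales
    have "idx -` {n} \<inter> space M = {x \<in> space M. idx x = n}" for n by blast
    then show "idx \<in> measurable M (count_space UNIV)"
      using sets_level by (simp add: measurable_count_space_eq_countable)
  qed (use idx_f pos zero_one sets_level in \<open>auto simp: atom_def\<close>)
  then show ?thesis by blast
qed

text \<open>Some set \<open>E i\<close> of an exhaustion by finite measure meets the atom in
  positive measure; the rest of the atom is then null.\<close>

lemma emeasure_atom_finite:
  assumes A: "atom M A"
  shows "emeasure M A < \<infinity>"
proof -
  obtain E :: "nat \<Rightarrow> 'a set" where E: "range E \<subseteq> sets M" "(\<Union>i. E i) = space M" "\<And>i. emeasure M (E i) \<noteq> \<infinity>"
    using sigma_finite by blast
  have As: "A \<in> sets M" "0 < emeasure M A" using A by (auto simp: atom_def)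
  have "\<exists>i. emeasure M (A \<inter> E i) \<noteq> 0"
  proof (rule ccontr)
    assume "\<not> ?thesis"
    then have "(\<Union>i. A \<inter> E i) \<in> null_sets M" using E As by (intro null_sets_UN) (auto simp: null_sets_def)
    moreover have "(\<Union>i. A \<inter> E i) = A" using E(2) As(1) sets.sets_into_space by fastforce
    ultimately show False using As by (simp add: null_sets_def)
  qed
  then obtain i where i: "emeasure M (A \<inter> E i) \<noteq> 0" by blast
  have AE: "A \<inter> E i \<in> sets M" using As E by auto
  then have "emeasure M (A - A \<inter> E i) = 0" using A i unfolding atom_def by blast
  then have "A - A \<inter> E i \<in> null_sets M" using As AE by auto
  then have "emeasure M ((A \<inter> E i) \<union> (A - A \<inter> E i)) = emeasure M (A \<inter> E i)"
    using AE by (rule emeasure_Un_null_set[rotated])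
  also have "(A \<inter> E i) \<union> (A - A \<inter> E i) = A" by blast
  also have "emeasure M (A \<inter> E i) \<le> emeasure M (E i)" using E by (intro emeasure_mono) auto
  also have "\<dots> < \<infinity>" using E(3)[of i] by (simp add: top.not_eq_extremum)
  finally show ?thesis .
qed

text \<open>Each basic open set has a preimage that is null or conull in the atom. Off the countably
  many null preimages, two different values would have disjoint neighbourhoods with non-null
  preimages, which an atom forbids.\<close>

lemma AE_const_on_atom:
  fixes \<phi> :: "'a \<Rightarrow> 'b::{second_countable_topology, t2_space}"
  assumes A: "atom M A" and \<phi>: "\<phi> \<in> borel_measurable M"
  shows "\<exists>v. AE x in M. x \<in> A \<longrightarrow> \<phi> x = v"
proof -
  obtain \<B> :: "'b set set" where \<B>: "countable \<B>" "topological_basis \<B>"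
    using ex_countable_basis by blast
  have As: "A \<in> sets M" "0 < emeasure M A" using A by (auto simp: atom_def)
  have pre: "\<phi> -` b \<inter> A \<in> sets M" if "b \<in> \<B>" for b
  proof -
    have "\<phi> -` b \<inter> space M \<in> sets M"
      using \<phi> topological_basis_open[OF \<B>(2) that] by (simp add: measurable_sets)
    moreover have "\<phi> -` b \<inter> A = (\<phi> -` b \<inter> space M) \<inter> A" using As sets.sets_into_space by blast
    ultimately show ?thesis using As by auto
  qed
  define N where "N = (\<Union>b\<in>{b \<in> \<B>. emeasure M (\<phi> -` b \<inter> A) = 0}. \<phi> -` b \<inter> A)"
  have N: "N \<in> null_sets M"
    unfolding N_def using \<B>(1) pre by (intro null_sets_UN') (auto simp: null_sets_def)
  have eq: "\<phi> x = \<phi> y" if x: "x \<in> A - N" and y: "y \<in> A - N" for x y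
  proof (rule ccontr)
    assume "\<phi> x \<noteq> \<phi> y"
    then obtain U V where UV: "open U" "open V" "\<phi> x \<in> U" "\<phi> y \<in> V" "U \<inter> V = {}"
      using hausdorff[OF \<open>\<phi> x \<noteq> \<phi> y\<close>] by blast
    obtain b where b: "b \<in> \<B>" "\<phi> x \<in> b" "b \<subseteq> U" using topological_basisE[OF \<B>(2) UV(1,3)] .
    obtain b' where b': "b' \<in> \<B>" "\<phi> y \<in> b'" "b' \<subseteq> V" using topological_basisE[OF \<B>(2) UV(2,4)] .
    have "emeasure M (\<phi> -` b \<inter> A) \<noteq> 0" "emeasure M (\<phi> -` b' \<inter> A) \<noteq> 0"
      using x y b b' unfolding N_def by auto
    moreover from this have "emeasure M (A - \<phi> -` b \<inter> A) = 0"
      using A pre[OF b(1)] unfolding atom_def by blast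
    moreover have "emeasure M (\<phi> -` b' \<inter> A) \<le> emeasure M (A - \<phi> -` b \<inter> A)"
      using pre[OF b(1)] As UV(5) b(3) b'(3) by (intro emeasure_mono) auto
    ultimately show False by simp
  qed
  have "A - N \<noteq> {}"
  proof
    assume "A - N = {}"
    then have "A \<subseteq> N" by blast
    then have "emeasure M A \<le> emeasure M N" using N by (intro emeasure_mono) auto
    then show False using As N by auto
  qed
  then obtain x where x: "x \<in> A - N" by blast
  have "AE y in M. y \<notin> N" using AE_not_in[OF N] .
  then have "AE y in M. y \<in> A \<longrightarrow> \<phi> y = \<phi> x" by eventually_elim (use eq x in blast)
  then show ?thesis by blast
qed

end

section \<open>Masses of the levels\<close>

context atomic_tower
begin

text \<open>The weights of the sequence space, taken as reals; this loses nothing, since atoms have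
  finite measure.\<close>

definition mass :: "int \<Rightarrow> real" where
  "mass k = measure M {x \<in> space M. idx x = k}"

lemma level_sets [measurable]: "{x \<in> space M. idx x = k} \<in> sets M"
  using level_atom by (auto simp: atom_def)

lemma idx_sets: "{x \<in> space M. P (idx x)} \<in> sets M"
proof -
  have "{x \<in> space M. P (idx x)} = idx -` Collect P \<inter> space M" by blast
  then show ?thesis using measurable_sets[OF idx_measurable, of "Collect P"] by simp
qed

lemma emeasure_level: "emeasure M {x \<in> space M. idx x = k} = ennreal (mass k)"
  unfolding mass_def using emeasure_atom_finite[OF level_atom]
  by (intro emeasure_eq_ennreal_measure) (auto simp: less_top)

lemma mass_pos: "0 < mass k"
  using level_atom[of k] emeasure_level[of k] by (auto simp: atom_def ennreal_less_zero_iff)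

text \<open>The bound on preimages is applied to level \<open>k\<close>, whose preimage is level
  \<open>k - 1\<close>. The constant is raised to at least 1 so that its powers increase.\<close>

lemma mass_step: "\<exists>c\<ge>1. \<forall>k. mass (k - 1) \<le> c * mass k"
proof -
  obtain c where c: "c > 0" "\<And>B. B \<in> sets M \<Longrightarrow> emeasure M (f -` B \<inter> space M) \<le> ennreal c * emeasure M B"
    using bounded by auto
  have "mass (k - 1) \<le> max 1 c * mass k" for k
  proof -
    have "f x \<in> space M" if "x \<in> space M" for x using funpow_space[OF that, of 1] by simp
    then have "f -` {x \<in> space M. idx x = k} \<inter> space M = {x \<in> space M. idx x = k - 1}"
      using idx_f by auto
    then have "ennreal (mass (k - 1)) \<le> ennreal c * ennreal (mass k)"
      using c(2)[OF level_sets[of k]] by (simp add: emeasure_level)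
    then have "mass (k - 1) \<le> c * mass k"
      using c(1) mass_pos[of k] by (simp add: ennreal_mult[symmetric])
    also have "\<dots> \<le> max 1 c * mass k" using mass_pos[of k] by (intro mult_right_mono) auto
    finally show ?thesis .
  qed
  then show ?thesis by (intro exI[of _ "max 1 c"]) auto
qed

text \<open>There are countably many levels, so the exceptional null sets of the individual atoms
  unite to a null set.\<close>

lemma AE_factor:
  fixes \<phi> :: "'a \<Rightarrow> 'b::{second_countable_topology, t2_space}"
  assumes "\<phi> \<in> borel_measurable M"
  shows "\<exists>c. AE x in M. \<phi> x = c (idx x)"
proof -
  have "\<exists>v. AE x in M. x \<in> {x \<in> space M. idx x = k} \<longrightarrow> \<phi> x = v" for k
    by (rule AE_const_on_atom[OF level_atom assms])
  then obtain c where c: "\<And>k. AE x in M. x \<in> {x \<in> space M. idx x = k} \<longrightarrow> \<phi> x = c k" by metis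
  have "AE x in M. \<forall>k. x \<in> {x \<in> space M. idx x = k} \<longrightarrow> \<phi> x = c k"
    using c by (simp only: AE_all_countable) blast
  then have "AE x in M. \<phi> x = c (idx x)" using AE_space by eventually_elim auto
  then show ?thesis by blast
qed

lemma integrable_finite_support:
  fixes g :: "int \<Rightarrow> real"
  assumes "finite J" "\<And>k. k \<notin> J \<Longrightarrow> g k = 0"
  shows "integrable M (\<lambda>x. g (idx x))"
proof -
  have "integrable M (\<lambda>x. \<Sum>k\<in>J. g k * indicator {x \<in> space M. idx x = k} x)"
    using emeasure_level by (intro Bochner_Integration.integrable_sum integrable_mult_right) auto
  moreover have "(\<Sum>k\<in>J. g k * indicator {x \<in> space M. idx x = k} x) = g (idx x)" if "x \<in> space M" for x
  proof -
    have "(\<Sum>k\<in>J. g k * indicator {x \<in> space M. idx x = k} x) = (\<Sum>k\<in>J. if k = idx x then g k else 0)"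
      using that by (intro sum.cong) (auto simp: indicator_def)
    then show ?thesis using assms by simp
  qed
  ultimately show ?thesis by (subst Bochner_Integration.integrable_cong[OF refl, symmetric])
qed

text \<open>Stands in for the integral as a weighted series over the integers: finite partial sums
  suffice to extract information on coordinates.\<close>

lemma sum_mass_le_integral:
  fixes g :: "int \<Rightarrow> real"
  assumes g: "integrable M (\<lambda>x. g (idx x))" "\<And>k. 0 \<le> g k" and J: "finite J"
  shows "(\<Sum>k\<in>J. g k * mass k) \<le> (LINT x|M. g (idx x))"
proof -
  have int: "integrable M (\<lambda>x. indicator {x \<in> space M. idx x = k} x :: real)" for k
    using emeasure_level[of k] by simp
  have "(\<Sum>k\<in>J. g k * mass k) = (LINT x|M. (\<Sum>k\<in>J. g k * indicator {x \<in> space M. idx x = k} x))"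
    using int by (subst Bochner_Integration.integral_sum) (auto simp: mass_def)
  also have "\<dots> \<le> (LINT x|M. g (idx x))"
  proof (rule integral_mono)
    fix x assume "x \<in> space M"
    then have "(\<Sum>k\<in>J. g k * indicator {x \<in> space M. idx x = k} x) = (\<Sum>k\<in>J. if k = idx x then g k else 0)"
      by (intro sum.cong) (auto simp: indicator_def)
    then show "(\<Sum>k\<in>J. g k * indicator {x \<in> space M. idx x = k} x) \<le> g (idx x)"
      using J g(2) by simp
  qed (use g int in auto)
  finally show ?thesis .
qed

text \<open>The sets where \<open>\<bar>idx x\<bar> \<le> int n\<close> are finite unions of levels
  and increase to the whole space.\<close>

lemma finite_measure_of_bounded_sums:
  assumes "\<And>J. finite J \<Longrightarrow> (\<Sum>k\<in>J. mass k) \<le> B"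
  shows "emeasure M (space M) < \<infinity>"
proof -
  have le: "emeasure M {x \<in> space M. \<bar>idx x\<bar> \<le> int n} \<le> ennreal B" for n
  proof -
    have "{x \<in> space M. \<bar>idx x\<bar> \<le> int n} = (\<Union>k\<in>{- int n..int n}. {x \<in> space M. idx x = k})"
      by auto
    also have "emeasure M \<dots> = (\<Sum>k\<in>{- int n..int n}. emeasure M {x \<in> space M. idx x = k})"
      by (intro sum_emeasure[symmetric]) (auto simp: disjoint_family_on_def)
    also have "\<dots> = ennreal (\<Sum>k\<in>{- int n..int n}. mass k)"
      by (simp add: emeasure_level sum_ennreal less_imp_le[OF mass_pos])
    also have "\<dots> \<le> ennreal B" using assms by (intro ennreal_leI) simp
    finally show ?thesis .
  qed
  have sets: "{x \<in> space M. \<bar>idx x\<bar> \<le> int n} \<in> sets M" for n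
    by (rule idx_sets)
  have "(SUP n. emeasure M {x \<in> space M. \<bar>idx x\<bar> \<le> int n})
      = emeasure M (\<Union>n. {x \<in> space M. \<bar>idx x\<bar> \<le> int n})"
    by (rule SUP_emeasure_incseq) (use sets in \<open>auto simp: incseq_def\<close>)
  moreover have "(\<Union>n. {x \<in> space M. \<bar>idx x\<bar> \<le> int n}) = space M"
  proof
    show "space M \<subseteq> (\<Union>n. {x \<in> space M. \<bar>idx x\<bar> \<le> int n})"
    proof
      fix x assume "x \<in> space M"
      then have "x \<in> {x \<in> space M. \<bar>idx x\<bar> \<le> int (nat \<bar>idx x\<bar>)}" by simp
      then show "x \<in> (\<Union>n. {x \<in> space M. \<bar>idx x\<bar> \<le> int n})" by blast
    qed
  qed blast
  moreover have "(SUP n. emeasure M {x \<in> space M. \<bar>idx x\<bar> \<le> int n}) \<le> ennreal B"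
    by (rule SUP_least) (rule le)
  ultimately have "emeasure M (space M) \<le> ennreal B" by (simp only:)
  then show ?thesis by (rule le_less_trans) simp
qed

end

section \<open>The shift on sequences\<close>

context atomic_tower
begin

text \<open>The weighted space \<open>\<ell>\<^sup>p(\<int>, a)\<close>, encoded by integrals over
  \<open>M\<close> instead of series so that facts about \<open>Lp_fun\<close> carry over
  directly.\<close>

definition seq_Lp :: "real \<Rightarrow> (int \<Rightarrow> 'k::{real_normed_field, banach, second_countable_topology}) set" where
  "seq_Lp p = {c. integrable M (\<lambda>x. norm (c (idx x)) powr p)}"

definition seq_class ::
    "real \<Rightarrow> (int \<Rightarrow> 'k::{real_normed_field, banach, second_countable_topology}) \<Rightarrow> ('a \<Rightarrow> 'k) set" where
  "seq_class p c = Lp_rel M p `` {\<lambda>x. c (idx x)}"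

lemma idx_comp_measurable [measurable]: "(\<lambda>x. c (idx x)) \<in> borel_measurable M"
  by (rule measurable_compose[OF idx_measurable]) simp

lemma seq_Lp_iff: "c \<in> seq_Lp p \<longleftrightarrow> (\<lambda>x. c (idx x)) \<in> Lp_fun M p"
  by (simp add: seq_Lp_def Lp_fun_def)

lemma seq_class_in_Lp: "c \<in> seq_Lp p \<Longrightarrow> seq_class p c \<in> Lp_space M p"
  unfolding seq_class_def Lp_space_def seq_Lp_iff by (rule quotientI)

lemma seq_class_self: "c \<in> seq_Lp p \<Longrightarrow> (\<lambda>x. c (idx x)) \<in> seq_class p c"
  unfolding seq_class_def seq_Lp_iff by (rule equiv_class_self[OF Lp_rel_equiv])

lemma seq_class_eqI:
  assumes "F \<in> Lp_space M p" "\<phi> \<in> F" "c \<in> seq_Lp p" "AE x in M. \<phi> x = c (idx x)"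
  shows "F = seq_class p c"
  using Lp_class_eqI[OF assms(1) seq_class_in_Lp[OF assms(3)] assms(2) seq_class_self[OF assms(3)] assms(4)] .

text \<open>A representative is almost everywhere a function of \<open>idx\<close> by
  \<open>AE_factor\<close>, so every vector can be handled as a sequence.\<close>

lemma Lp_space_seq:
  fixes F :: "('a \<Rightarrow> 'k::{real_normed_field, banach, second_countable_topology}) set"
  assumes F: "F \<in> Lp_space M p"
  obtains c where "c \<in> seq_Lp p" "F = seq_class p c"
proof -
  obtain \<phi> where \<phi>: "\<phi> \<in> F" using Lp_some[OF F] by blast
  then have m: "\<phi> \<in> borel_measurable M" and i: "integrable M (\<lambda>x. norm (\<phi> x) powr p)"
    using Lp_space_subset[OF F] by (auto simp: Lp_fun_def)
  obtain c where c: "AE x in M. \<phi> x = c (idx x)" using AE_factor[OF m] by blast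
  have "integrable M (\<lambda>x. norm (c (idx x)) powr p)"
  proof (subst integrable_cong_AE)
    show "AE x in M. norm (c (idx x)) powr p = norm (\<phi> x) powr p" using c by eventually_elim simp
  qed (use m i in auto)
  then have "c \<in> seq_Lp p" by (simp add: seq_Lp_def)
  with seq_class_eqI[OF F \<phi> this c] that show thesis by blast
qed

text \<open>The identity \<open>idx (f x) = idx x + 1\<close> turns composition with
  \<open>f\<close> into the backward shift.\<close>

lemma comp_op_seq_class:
  fixes c :: "int \<Rightarrow> 'k::{real_normed_field, banach, second_countable_topology}"
  assumes c: "c \<in> seq_Lp p"
  shows "(\<lambda>k. c (k + 1)) \<in> seq_Lp p"
    and "composition_operator M p f (seq_class p c) = seq_class p (\<lambda>k. c (k + 1))"
proof -
  let ?F = "seq_class p c"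
  note T = composition_operator_class[OF seq_class_in_Lp[OF c] seq_class_self[OF c]]
  have ae: "AE x in M. ((\<lambda>x. c (idx x)) \<circ> f) x = c (idx x + 1)"
    using AE_space by eventually_elim (simp add: idx_f)
  have "integrable M (\<lambda>x. norm (((\<lambda>x. c (idx x)) \<circ> f) x) powr p)"
    using T Lp_space_subset unfolding Lp_fun_def by blast
  then have "integrable M (\<lambda>x. norm (c (idx x + 1)) powr p)"
    by (rule Bochner_Integration.integrable_cong[OF refl, THEN iffD1, rotated]) (simp add: idx_f)
  then show s: "(\<lambda>k. c (k + 1)) \<in> seq_Lp p" by (simp add: seq_Lp_def)
  show "composition_operator M p f ?F = seq_class p (\<lambda>k. c (k + 1))"
    by (rule seq_class_eqI[OF T s]) (use ae in simp)
qed

lemma comp_op_power_seq_class: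
  fixes c :: "int \<Rightarrow> 'k::{real_normed_field, banach, second_countable_topology}"
  assumes c: "c \<in> seq_Lp p"
  shows "(\<lambda>k. c (k + int n)) \<in> seq_Lp p"
    and "(composition_operator M p f ^^ n) (seq_class p c) = seq_class p (\<lambda>k. c (k + int n))"
proof -
  have "(\<lambda>k. c (k + int n)) \<in> seq_Lp p \<and>
    (composition_operator M p f ^^ n) (seq_class p c) = seq_class p (\<lambda>k. c (k + int n))"
  proof (induction n)
    case (Suc n)
    then show ?case
      using comp_op_seq_class[of "\<lambda>k. c (k + int n)" p] by (simp add: add.assoc add.commute[of 1])
  qed (use c in simp)
  then show "(\<lambda>k. c (k + int n)) \<in> seq_Lp p"
    and "(composition_operator M p f ^^ n) (seq_class p c) = seq_class p (\<lambda>k. c (k + int n))"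
    by blast+
qed

lemma seq_diff_integrable:
  assumes "1 \<le> p" "c \<in> seq_Lp p" "d \<in> seq_Lp p"
  shows "integrable M (\<lambda>x. norm (c (idx x) - d (idx x)) powr p)"
  using Lp_fun_diff[OF assms(1) assms(2,3)[unfolded seq_Lp_iff]] by (simp add: Lp_fun_def)

text \<open>Passing to \<open>p\<close>-th powers, which is monotone, keeps roots out of the later
  estimates.\<close>

lemma dist_seq_class_less_iff:
  assumes p: "1 \<le> p" and "c \<in> seq_Lp p" "d \<in> seq_Lp p" and r: "0 < r"
  shows "Lp_dist M p (seq_class p c) (seq_class p d) < r
    \<longleftrightarrow> (LINT x|M. norm (c (idx x) - d (idx x)) powr p) < r powr p"
proof -
  let ?N = "Lp_norm M p (\<lambda>x. c (idx x) - d (idx x))"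
  have "Lp_dist M p (seq_class p c) (seq_class p d) = ?N"
    using assms by (intro Lp_dist_class seq_class_in_Lp seq_class_self)
  moreover have "?N < r \<longleftrightarrow> ?N powr p < r powr p"
    using p r Lp_norm_nonneg[of M p "\<lambda>x. c (idx x) - d (idx x)"]
    by (meson less_eq_real_def not_less powr_less_mono2 powr_mono2 less_le_trans zero_less_one)
  ultimately show ?thesis by (simp add: Lp_norm_powr[OF p])
qed

lemma finite_support_seq_Lp:
  assumes "finite J" "\<And>k. k \<notin> J \<Longrightarrow> c k = 0"
  shows "c \<in> seq_Lp p"
  unfolding seq_Lp_def using integrable_finite_support[OF assms(1), of "\<lambda>k. norm (c k) powr p"] assms(2) by simp

subsection \<open>Frequent returns force finite measure\<close>

definition unit_seq :: "int \<Rightarrow> 'k::{real_normed_field, banach, second_countable_topology}" where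
  "unit_seq k = (if k = 0 then 1 else 0)"

lemma unit_seq_Lp: "unit_seq \<in> seq_Lp p"
  by (rule finite_support_seq_Lp[of "{0}"]) (auto simp: unit_seq_def)

text \<open>Half the norm of \<open>unit_seq\<close>.\<close>

definition unit_radius :: "real \<Rightarrow> real" where
  "unit_radius p = mass 0 powr (1 / p) / 2"

lemma unit_radius: "0 < unit_radius p" "1 \<le> p \<Longrightarrow> unit_radius p powr p = mass 0 / 2 powr p"
  using mass_pos[of 0] by (auto simp: unit_radius_def powr_divide powr_powr)

text \<open>All coordinate errors together weigh less than \<open>mass 0 / 2 powr p\<close>.
  Coordinate 0 alone is therefore within 1/2 of 1, while elsewhere \<open>unit_seq\<close> vanishes
  and the error is the coordinate itself.\<close>

lemma near_unit_seq:
  fixes c :: "int \<Rightarrow> 'k::{real_normed_field, banach, second_countable_topology}"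
  assumes p: "1 \<le> p" and c: "c \<in> seq_Lp p"
    and near: "Lp_dist M p (seq_class p (\<lambda>k. c (k + int n))) (seq_class p unit_seq) < unit_radius p"
  shows "1 / 2 < norm (c (int n))"
    and "finite J \<Longrightarrow> 0 \<notin> J \<Longrightarrow> (\<Sum>k\<in>J. norm (c (k + int n)) powr p * mass k) \<le> mass 0 / 2 powr p"
proof -
  let ?c = "\<lambda>k. c (k + int n)"
  have sc: "?c \<in> seq_Lp p" by (rule comp_op_power_seq_class(1)[OF c])
  have int: "integrable M (\<lambda>x. norm (?c (idx x) - unit_seq (idx x)) powr p)"
    by (rule seq_diff_integrable[OF p sc unit_seq_Lp])
  have less: "(LINT x|M. norm (?c (idx x) - unit_seq (idx x)) powr p) < mass 0 / 2 powr p"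
    using near dist_seq_class_less_iff[OF p sc unit_seq_Lp unit_radius(1)] unit_radius(2)[OF p] by simp
  have sum: "(\<Sum>k\<in>J. norm (?c k - unit_seq k) powr p * mass k) < mass 0 / 2 powr p" if "finite J" for J
    using sum_mass_le_integral[of "\<lambda>k. norm (?c k - unit_seq k) powr p", OF int _ that] less by simp
  have "norm (c (int n) - 1) powr p * mass 0 < mass 0 / 2 powr p"
    using sum[of "{0}"] by (simp add: unit_seq_def)
  then have "norm (c (int n) - 1) powr p < (1 / 2) powr p"
    using mass_pos[of 0] by (simp add: powr_divide field_simps)
  then have "norm (c (int n) - 1) < 1 / 2"
    using powr_mono2[of p "1 / 2" "norm (c (int n) - 1)"] p by fastforce
  moreover have "norm (1 :: 'k) \<le> norm (c (int n)) + norm (c (int n) - 1)"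
    using norm_triangle_ineq4[of "c (int n)" "c (int n) - 1"] by simp
  ultimately show "1 / 2 < norm (c (int n))" by simp
  assume J: "finite J" "0 \<notin> J"
  then have "(\<Sum>k\<in>J. norm (c (k + int n)) powr p * mass k) = (\<Sum>k\<in>J. norm (?c k - unit_seq k) powr p * mass k)"
    by (intro sum.cong) (auto simp: unit_seq_def)
  with sum[OF J(1)] show "(\<Sum>k\<in>J. norm (c (k + int n)) powr p * mass k) \<le> mass 0 / 2 powr p" by simp
qed

text \<open>Seen from a return time \<open>n\<close>, another return time \<open>m\<close> is a
  coordinate at position \<open>m - n\<close> of size above 1/2, so the corresponding masses
  \<open>mass (m - n)\<close> are controlled by the distance to \<open>unit_seq\<close>.\<close>

lemma finite_of_frequent_returns:
  fixes F :: "('a \<Rightarrow> 'k::{real_normed_field, banach, second_countable_topology}) set"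
  assumes p: "1 \<le> p" and F: "F \<in> Lp_space M p"
    and \<delta>: "0 < \<delta>" "\<forall>\<^sub>F N in sequentially. \<delta> * real N \<le> card {n \<in> {1..N}.
      Lp_dist M p ((composition_operator M p f ^^ n) F) (seq_class p unit_seq) < unit_radius p}"
  shows "emeasure M (space M) < \<infinity>"
proof -
  obtain c where c: "c \<in> seq_Lp p" "F = seq_class p c" using Lp_space_seq[OF F] .
  define near where "near n \<longleftrightarrow>
    Lp_dist M p (seq_class p (\<lambda>k. c (k + int n))) (seq_class p unit_seq) < unit_radius p" for n
  note near = near_unit_seq[OF p c(1), folded near_def]
  define A where "A = int ` {n. near n}"
  obtain b where b: "1 \<le> b" "\<And>k. mass (k - 1) \<le> b * mass k" using mass_step by blast
  have card_A: "card {n \<in> {1..N}. near n} = card (A \<inter> {1..int N})" for N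
  proof -
    have "A \<inter> {1..int N} = int ` {n \<in> {1..N}. near n}" unfolding A_def by auto
    then show ?thesis by (simp add: card_image)
  qed
  have "\<exists>B. \<forall>J. finite J \<longrightarrow> (\<Sum>k\<in>J. mass k) \<le> B"
  \<comment> \<open>The term \<open>m = l\<close> contributes \<open>mass 0\<close>, and all other
    terms together at most \<open>mass 0\<close>.\<close>
  proof (rule bounded_sums_of_dense_returns[where C = "2 * mass 0" and A = A])
    show "0 \<le> mass k" for k by (rule less_imp_le[OF mass_pos])
    then show "0 \<le> 2 * mass 0" by simp
    show "\<forall>\<^sub>F N in sequentially. \<delta> * real N \<le> card (A \<inter> {1..int N})"
      using \<delta>(2) unfolding card_A[symmetric] near_def c(2) comp_op_power_seq_class(2)[OF c(1)] .
    fix l S assume l: "l \<in> A" and S: "finite S" "S \<subseteq> A"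
    obtain n where n: "l = int n" "near n" using l by (auto simp: A_def)
    have "(\<Sum>m\<in>S - {l}. mass (m - l)) \<le> (\<Sum>m\<in>S - {l}. 2 powr p * (norm (c m) powr p * mass (m - l)))"
    proof (rule sum_mono)
      fix m assume "m \<in> S - {l}"
      then have "1 / 2 < norm (c m)" using S(2) near(1) by (auto simp: A_def)
      then have "1 \<le> (2 * norm (c m)) powr p" using p by (intro ge_one_powr_ge_zero) auto
      then have "1 \<le> 2 powr p * norm (c m) powr p" by (simp add: powr_mult)
      then have "1 * mass (m - l) \<le> (2 powr p * norm (c m) powr p) * mass (m - l)"
        by (intro mult_right_mono less_imp_le[OF mass_pos])
      then show "mass (m - l) \<le> 2 powr p * (norm (c m) powr p * mass (m - l))" by (simp add: mult.assoc)
    qed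
    also have "\<dots> = 2 powr p * (\<Sum>k\<in>(\<lambda>m. m - l) ` (S - {l}). norm (c (k + int n)) powr p * mass k)"
      by (subst sum.reindex) (auto simp: inj_on_def sum_distrib_left n)
    also have "\<dots> \<le> 2 powr p * (mass 0 / 2 powr p)"
      using S by (intro mult_left_mono near(2)[OF n(2)]) auto
    finally have 1: "(\<Sum>m\<in>S - {l}. mass (m - l)) \<le> mass 0" by simp
    have "(\<Sum>m\<in>S. mass (m - l)) \<le> (\<Sum>m\<in>insert l (S - {l}). mass (m - l))"
      using S less_imp_le[OF mass_pos] by (intro sum_mono2) auto
    also have "\<dots> = mass 0 + (\<Sum>m\<in>S - {l}. mass (m - l))"
      by (subst sum.insert) (use S in auto)
    finally show "(\<Sum>m\<in>S. mass (m - l)) \<le> 2 * mass 0" using 1 by simp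
  qed (use b \<delta> in auto)
  then show ?thesis using finite_measure_of_bounded_sums by blast
qed

end

section \<open>Positive lower density and transitivity\<close>

text \<open>Replaces a limit of extended reals by a linear lower bound on counts. Passing to large
  \<open>N\<close> excludes \<open>N = 0\<close>, where the quotient divides by zero.\<close>

lemma liminf_density_pos_iff:
  "0 < liminf (\<lambda>N. ereal (real (card {n \<in> {1..N}. P n}) / real N))
    \<longleftrightarrow> (\<exists>\<delta>>0. \<forall>\<^sub>F N in sequentially. \<delta> * real N \<le> card {n \<in> {1..N}. P n})"
proof
  assume "0 < liminf (\<lambda>N. ereal (real (card {n \<in> {1..N}. P n}) / real N))"
  then obtain \<delta> where \<delta>: "0 < ereal \<delta>"
      "ereal \<delta> < liminf (\<lambda>N. ereal (real (card {n \<in> {1..N}. P n}) / real N))"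
    using ereal_dense2 by blast
  have "\<forall>\<^sub>F N in sequentially. \<delta> * real N \<le> card {n \<in> {1..N}. P n}"
    using less_LiminfD[OF \<delta>(2)] eventually_gt_at_top[of 0] by eventually_elim (simp add: field_simps)
  then show "\<exists>\<delta>>0. \<forall>\<^sub>F N in sequentially. \<delta> * real N \<le> card {n \<in> {1..N}. P n}"
    using \<delta>(1) by auto
next
  assume "\<exists>\<delta>>0. \<forall>\<^sub>F N in sequentially. \<delta> * real N \<le> card {n \<in> {1..N}. P n}"
  then obtain \<delta> where \<delta>: "0 < \<delta>" "\<forall>\<^sub>F N in sequentially. \<delta> * real N \<le> card {n \<in> {1..N}. P n}" by blast
  have "\<forall>\<^sub>F N in sequentially. ereal \<delta> \<le> ereal (real (card {n \<in> {1..N}. P n}) / real N)"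
    using \<delta>(2) eventually_gt_at_top[of 0] by eventually_elim (simp add: field_simps)
  then have "ereal \<delta> \<le> liminf (\<lambda>N. ereal (real (card {n \<in> {1..N}. P n}) / real N))"
    by (rule Liminf_bounded)
  then show "0 < liminf (\<lambda>N. ereal (real (card {n \<in> {1..N}. P n}) / real N))"
    using \<delta>(1) by (meson ereal_less(2) less_le_trans)
qed

text \<open>Visit times of positive lower density are unbounded, so an orbit that visits
  \<open>U\<close> at time \<open>n\<close> visits \<open>V\<close> at a later time
  \<open>m\<close>, and the power \<open>m - n\<close> does the job.\<close>

lemma frequently_hypercyclic_imp_transitive:
  assumes "frequently_hypercyclic H T"
  shows "topologically_transitive H T"
  unfolding topologically_transitive_def
proof (intro allI impI)
  fix U V assume UV: "openin H U \<and> U \<noteq> {} \<and> openin H V \<and> V \<noteq> {}"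
  obtain x where x: "\<And>U. openin H U \<Longrightarrow> U \<noteq> {} \<Longrightarrow>
      \<exists>\<delta>>0. \<forall>\<^sub>F N in sequentially. \<delta> * real N \<le> card {n \<in> {1..N}. (T ^^ n) x \<in> U}"
    using assms unfolding frequently_hypercyclic_def liminf_density_pos_iff by blast
  have visit: "\<exists>n>m. (T ^^ n) x \<in> U" if U: "openin H U" "U \<noteq> {}" for U m
  proof (rule ccontr)
    assume none: "\<not> ?thesis"
    obtain \<delta> where \<delta>: "0 < \<delta>" "\<forall>\<^sub>F N in sequentially. \<delta> * real N \<le> card {n \<in> {1..N}. (T ^^ n) x \<in> U}"
      using x[OF U] by blast
    have "\<forall>\<^sub>F N in sequentially. \<delta> * real N \<le> real m"
      using \<delta>(2)
    proof eventually_elim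
      case (elim N)
      have "{n \<in> {1..N}. (T ^^ n) x \<in> U} \<subseteq> {1..m}" using none by (auto simp: not_less[symmetric])
      then have "card {n \<in> {1..N}. (T ^^ n) x \<in> U} \<le> m" using card_mono[of "{1..m}"] by fastforce
      then show ?case using elim by linarith
    qed
    then obtain K where K: "\<And>N. K \<le> N \<Longrightarrow> \<delta> * real N \<le> real m" unfolding eventually_sequentially by blast
    obtain N :: nat where N: "real m / \<delta> < N" using reals_Archimedean2 by blast
    have "real m < \<delta> * real (max K N)"
    proof -
      have "real m < \<delta> * real N" using N \<delta>(1) by (simp add: field_simps)
      also have "\<dots> \<le> \<delta> * real (max K N)" using \<delta>(1) by (intro mult_left_mono) auto
      finally show ?thesis .
    qed
    then show False using K[of "max K N"] by simp
  qed
  obtain n where n: "(T ^^ n) x \<in> U" using visit UV by blast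
  obtain m where m: "m > n" "(T ^^ m) x \<in> V" using visit UV by blast
  have "(T ^^ (m - n)) ((T ^^ n) x) = (T ^^ m) x"
    using m(1) by (metis add.commute comp_apply funpow_add le_add_diff_inverse less_imp_le)
  then show "\<exists>k>0. (T ^^ k) ` U \<inter> V \<noteq> {}"
    using n m by (intro exI[of _ "m - n"]) (auto intro!: image_eqI)
qed

section \<open>Necessity of finite measure\<close>

context atomic_tower
begin

lemma unit_ball_open:
  fixes F :: "('a \<Rightarrow> 'k::{real_normed_field, banach, second_countable_topology}) set"
  assumes p: "1 \<le> p"
  defines "U \<equiv> {F :: ('a \<Rightarrow> 'k) set. F \<in> Lp_space M p \<and> Lp_dist M p F (seq_class p unit_seq) < unit_radius p}"
  shows "openin (Lp_topology M p) U" "seq_class p unit_seq \<in> U"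
proof -
  interpret L: Metric_space "Lp_space M p :: ('a \<Rightarrow> 'k) set set" "Lp_dist M p"
    by (rule Lp_Metric_space[OF p])
  have e: "(seq_class p unit_seq :: ('a \<Rightarrow> 'k) set) \<in> Lp_space M p" by (rule seq_class_in_Lp[OF unit_seq_Lp])
  have "U = L.mball (seq_class p unit_seq) (unit_radius p)"
    unfolding U_def using e L.commute by auto
  then show "openin (Lp_topology M p) U" "seq_class p unit_seq \<in> U"
    using e unit_radius(1) by (auto simp: Lp_topology_def)
qed

lemma topspace_Lp: "1 \<le> p \<Longrightarrow> topspace (Lp_topology M p) = Lp_space M p"
  unfolding Lp_topology_def by (rule Metric_space.topspace_mtopology[OF Lp_Metric_space])

lemma frequently_hypercyclic_imp_finite:
  assumes p: "1 \<le> p"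
    and fhc: "frequently_hypercyclic
      (Lp_topology M p :: ('a \<Rightarrow> 'k::{real_normed_field, banach, second_countable_topology}) set topology)
      (composition_operator M p f)"
  shows "emeasure M (space M) < \<infinity>"
proof -
  let ?U = "{F :: ('a \<Rightarrow> 'k) set. F \<in> Lp_space M p \<and> Lp_dist M p F (seq_class p unit_seq) < unit_radius p}"
  have U: "openin (Lp_topology M p) ?U" "?U \<noteq> {}" using unit_ball_open[OF p] by blast+
  obtain F :: "('a \<Rightarrow> 'k) set" where F: "F \<in> Lp_space M p" and
    F': "\<exists>\<delta>>0. \<forall>\<^sub>F N in sequentially. \<delta> * real N \<le> card {n \<in> {1..N}. (composition_operator M p f ^^ n) F \<in> ?U}"
    using fhc U unfolding frequently_hypercyclic_def liminf_density_pos_iff topspace_Lp[OF p] by blast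
  obtain c where c: "c \<in> seq_Lp p" "F = seq_class p c" using Lp_space_seq[OF F] .
  have "(composition_operator M p f ^^ n) F \<in> Lp_space M p" for n
    unfolding c(2) comp_op_power_seq_class(2)[OF c(1)]
    by (rule seq_class_in_Lp[OF comp_op_power_seq_class(1)[OF c(1)]])
  then show ?thesis using F' finite_of_frequent_returns[OF p F] by auto
qed

lemma chaotic_imp_finite:
  assumes p: "1 \<le> p"
    and chaos: "chaotic
      (Lp_topology M p :: ('a \<Rightarrow> 'k::{real_normed_field, banach, second_countable_topology}) set topology)
      (composition_operator M p f)"
  shows "emeasure M (space M) < \<infinity>"
proof -
  let ?T = "composition_operator M p f"
  let ?H = "Lp_topology M p :: ('a \<Rightarrow> 'k) set topology"
  let ?U = "{F :: ('a \<Rightarrow> 'k) set. F \<in> Lp_space M p \<and> Lp_dist M p F (seq_class p unit_seq) < unit_radius p}"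
  note U = unit_ball_open[OF p]
  have "seq_class p unit_seq \<in> ?H closure_of (periodic_points ?H ?T)"
    using chaos U openin_subset unfolding chaotic_def by blast
  then have "seq_class p unit_seq \<in> V \<and> openin ?H V \<longrightarrow> (\<exists>F. F \<in> periodic_points ?H ?T \<and> F \<in> V)" for V
    unfolding in_closure_of by blast
  from this[of ?U] U obtain F where F: "F \<in> periodic_points ?H ?T" "F \<in> ?U" by blast
  then obtain n where n: "0 < n" "(?T ^^ n) F = F" by (auto simp: periodic_points_def)
  have per: "(?T ^^ (n * t)) F = F" for t
    by (induction t) (use n(2) in \<open>simp_all add: funpow_add\<close>)
  \<comment> \<open>\<open>Suc t\<close> leaves out time 0, since visits are counted from time
    1.\<close>
  then have P: "Lp_dist M p ((?T ^^ (n * Suc t)) F) (seq_class p unit_seq) < unit_radius p" for t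
    unfolding per using F(2) by simp
  have "\<exists>\<delta>>0. \<forall>\<^sub>F N in sequentially. \<delta> * real N \<le> card {n \<in> {1..N}.
      Lp_dist M p ((?T ^^ n) F) (seq_class p unit_seq) < unit_radius p}"
    by (rule linear_growth_density[where g = "\<lambda>t. n * Suc t" and E = n])
      (use P n(1) in \<open>auto simp: inj_def\<close>)
  then obtain \<delta> where "0 < \<delta>" "\<forall>\<^sub>F N in sequentially. \<delta> * real N \<le> card {n \<in> {1..N}.
      Lp_dist M p ((?T ^^ n) F) (seq_class p unit_seq) < unit_radius p}" by blast
  moreover have "F \<in> Lp_space M p" using F(2) by simp
  ultimately show ?thesis by (intro finite_of_frequent_returns[OF p])
qed

end

section \<open>Finite measure implies chaos and frequent hypercyclicity\<close>

context atomic_tower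
begin

text \<open>Dominated convergence: at each point the integrand vanishes once \<open>n\<close>
  exceeds \<open>\<bar>idx x\<bar>\<close>. Admitting every larger cutoff lets several requirements
  be met by a maximum.\<close>

lemma tail_integral_small:
  fixes h :: "int \<Rightarrow> real"
  assumes h: "integrable M (\<lambda>x. h (idx x))" and e: "0 < e"
  obtains L :: nat where
    "\<And>L'. L \<le> L' \<Longrightarrow> (LINT x|M. (if int L' \<le> \<bar>idx x\<bar> then h (idx x) else 0)) < e"
proof -
  have "(\<lambda>n. LINT x|M. (if int n \<le> \<bar>idx x\<bar> then h (idx x) else 0)) \<longlonglongrightarrow> (LINT x|M. 0)"
  proof (rule integral_dominated_convergence)
    show "integrable M (\<lambda>x. norm (h (idx x)))" using h by simp
    show "AE x in M. (\<lambda>n. if int n \<le> \<bar>idx x\<bar> then h (idx x) else 0) \<longlonglongrightarrow> 0"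
    proof (rule AE_I2)
      fix x
      have "\<forall>\<^sub>F n in sequentially. (if int n \<le> \<bar>idx x\<bar> then h (idx x) else 0) = 0"
        using eventually_gt_at_top[of "nat \<bar>idx x\<bar>"] by eventually_elim auto
      then show "(\<lambda>n. if int n \<le> \<bar>idx x\<bar> then h (idx x) else 0) \<longlonglongrightarrow> 0"
        by (rule tendsto_eventually)
    qed
    show "(\<lambda>x. if int n \<le> \<bar>idx x\<bar> then h (idx x) else 0) \<in> borel_measurable M" for n
      by (rule idx_comp_measurable[of "\<lambda>k. if int n \<le> \<bar>k\<bar> then h k else 0"])
  qed auto
  then have "\<forall>\<^sub>F n in sequentially. (LINT x|M. (if int n \<le> \<bar>idx x\<bar> then h (idx x) else 0)) < e"
    using e by (intro order_tendstoD(2)[where y = 0]) auto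
  then show thesis using that unfolding eventually_sequentially by blast
qed

lemma integrable_bounded_by:
  fixes g h :: "int \<Rightarrow> real"
  assumes "integrable M (\<lambda>x. h (idx x))" "\<And>k. 0 \<le> g k" "\<And>k. g k \<le> h k"
  shows "integrable M (\<lambda>x. g (idx x))"
proof (rule Bochner_Integration.integrable_bound[OF assms(1)])
  show "AE x in M. norm (g (idx x)) \<le> norm (h (idx x))"
  proof (rule AE_I2)
    fix x
    show "norm (g (idx x)) \<le> norm (h (idx x))" using assms(2,3)[of "idx x"] by simp
  qed
qed (rule idx_comp_measurable)

lemma tail_integrable:
  fixes h :: "int \<Rightarrow> real"
  assumes "integrable M (\<lambda>x. h (idx x))" "\<And>k. 0 \<le> h k"
  shows "integrable M (\<lambda>x. if int L \<le> \<bar>idx x\<bar> then h (idx x) else 0)"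
  using integrable_bounded_by[OF assms(1), of "\<lambda>k. if int L \<le> \<bar>k\<bar> then h k else 0"] assms(2) by simp

lemma dist_seq_class_lessI:
  assumes p: "1 \<le> p" and cd: "c \<in> seq_Lp p" "d \<in> seq_Lp p" and r: "0 < r"
    and g: "integrable M (\<lambda>x. g (idx x))" "\<And>k. norm (c k - d k) powr p \<le> g k"
    and less: "(LINT x|M. g (idx x)) < r powr p"
  shows "Lp_dist M p (seq_class p c) (seq_class p d) < r"
proof -
  have "(LINT x|M. norm (c (idx x) - d (idx x)) powr p) \<le> (LINT x|M. g (idx x))"
    by (rule integral_mono[OF seq_diff_integrable[OF p cd] g(1)]) (rule g(2))
  with less show ?thesis using dist_seq_class_less_iff[OF p cd r] by simp
qed

end

section \<open>Approximation and periodic points for finite measure\<close>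

locale finite_tower = atomic_tower +
  assumes finite: "emeasure M (space M) < \<infinity>"
begin

sublocale finite_measure M
  using finite by unfold_locales auto

lemma bounded_seq_Lp:
  assumes "1 \<le> p" "\<And>k. norm (c k) \<le> B"
  shows "c \<in> seq_Lp p"
  unfolding seq_Lp_def
  using integrable_bounded_by[of "\<lambda>_. B powr p" "\<lambda>k. norm (c k) powr p"] assms
  by (simp add: powr_mono2)

text \<open>The tail beyond the block costs less than \<open>r powr p / 2\<close>; on the block,
  values are moved by less than \<open>e\<close> into \<open>D\<close>, which costs at most as much
  because the measure is finite. \<open>D\<close> will be all scalars for periodic points and a
  countable dense set for hypercyclicity.\<close>

lemma finite_support_approx:
  fixes c :: "int \<Rightarrow> 'k::{real_normed_field, banach, second_countable_topology}"
  assumes p: "1 \<le> p" and c: "c \<in> seq_Lp p" and r: "0 < r"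
    and D: "\<And>v e. 0 < e \<Longrightarrow> \<exists>d\<in>D. norm (v - d :: 'k) < e"
  obtains K :: nat and g where "\<And>k. g k \<in> D"
    "(\<lambda>k. if \<bar>k\<bar> \<le> int K then g k else 0) \<in> seq_Lp p"
    "Lp_dist M p (seq_class p c) (seq_class p (\<lambda>k. if \<bar>k\<bar> \<le> int K then g k else 0)) < r"
proof -
  have rp: "0 < r powr p / 2" using r by simp
  define m where "m = measure M (space M) + 1"
  have m: "0 < m" "measure M (space M) < m" by (auto simp: m_def add_nonneg_pos)
  \<comment> \<open>Chosen so that \<open>m * e powr p\<close> is exactly half of
    \<open>r powr p\<close>, where \<open>m\<close> exceeds the total measure.\<close>
  define e where "e = (r powr p / (2 * m)) powr (1 / p)"
  have e: "0 < e" "e powr p = r powr p / (2 * m)"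
    using r m p by (auto simp: e_def powr_powr)
  have ci: "integrable M (\<lambda>x. norm (c (idx x)) powr p)" using c by (simp add: seq_Lp_def)
  obtain L where "\<And>L'. L \<le> L' \<Longrightarrow>
      (LINT x|M. (if int L' \<le> \<bar>idx x\<bar> then norm (c (idx x)) powr p else 0)) < r powr p / 2"
    by (rule tail_integral_small[where h = "\<lambda>k. norm (c k) powr p", OF ci rp]) blast
  \<comment> \<open>The tail starts at \<open>Suc L\<close>, directly after the block
    \<open>\<bar>k\<bar> \<le> int L\<close>.\<close>
  from this[of "Suc L"]
  have L: "(LINT x|M. (if int (Suc L) \<le> \<bar>idx x\<bar> then norm (c (idx x)) powr p else 0)) < r powr p / 2"
    by simp
  have "\<forall>k. \<exists>d\<in>D. norm (c k - d) < e" using D[OF e(1)] by blast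
  then obtain g where g: "\<And>k. g k \<in> D" "\<And>k. norm (c k - g k) < e" by metis
  let ?d = "\<lambda>k. if \<bar>k\<bar> \<le> int L then g k else 0"
  let ?t = "\<lambda>k. if int (Suc L) \<le> \<bar>k\<bar> then norm (c k) powr p else 0"
  have d: "?d \<in> seq_Lp p" by (rule finite_support_seq_Lp[of "{- int L..int L}"]) auto
  have ti: "integrable M (\<lambda>x. ?t (idx x))"
    by (rule tail_integrable[of "\<lambda>k. norm (c k) powr p", OF ci]) simp
  have "Lp_dist M p (seq_class p c) (seq_class p ?d) < r"
  proof (rule dist_seq_class_lessI[OF p c d r])
    show "integrable M (\<lambda>x. ?t (idx x) + e powr p)"
      using ti by (intro Bochner_Integration.integrable_add) auto
    show "norm (c k - ?d k) powr p \<le> ?t k + e powr p" for k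
      using g(2)[of k] p by (auto intro!: powr_mono2)
    have "(LINT x|M. ?t (idx x) + e powr p) = (LINT x|M. ?t (idx x)) + measure M (space M) * e powr p"
      using ti by (subst Bochner_Integration.integral_add) auto
    also have "measure M (space M) * e powr p \<le> m * e powr p"
      using m by (intro mult_right_mono) auto
    also have "m * e powr p = r powr p / 2" using m by (simp add: e(2))
    finally show "(LINT x|M. ?t (idx x) + e powr p) < r powr p" using L by linarith
  qed
  with g(1) d that show thesis by blast
qed

text \<open>The block \<open>{- N..N}\<close> of a finitely supported approximation is repeated with
  period \<open>2 * N + 1\<close>. The error sits off the block and is at most \<open>B\<close>
  there, and constants have small tails for finite measure.\<close>

lemma periodic_points_dense:
  assumes p: "1 \<le> p"
  shows "(Lp_topology M p :: ('a \<Rightarrow> 'k::{real_normed_field, banach, second_countable_topology}) set topology)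
    closure_of (periodic_points (Lp_topology M p) (composition_operator M p f)) = topspace (Lp_topology M p)"
proof -
  let ?H = "Lp_topology M p :: ('a \<Rightarrow> 'k) set topology"
  let ?P = "periodic_points ?H (composition_operator M p f)"
  interpret L: Metric_space "Lp_space M p :: ('a \<Rightarrow> 'k) set set" "Lp_dist M p"
    by (rule Lp_Metric_space[OF p])
  have "\<exists>G\<in>?P. Lp_dist M p F G < r" if F: "F \<in> Lp_space M p" and r: "0 < r" for F r
  proof -
    obtain c where c: "c \<in> seq_Lp p" "F = seq_class p c" using Lp_space_seq[OF F] .
    have "\<exists>d\<in>UNIV. norm (v - d) < e" if "0 < e" for v :: 'k and e
      using that by (intro bexI[of _ v]) auto
    from finite_support_approx[OF p c(1) _ this, of "r / 2"] r
    obtain K g where K: "(\<lambda>k. if \<bar>k\<bar> \<le> int K then g k else 0) \<in> seq_Lp p"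
      "Lp_dist M p F (seq_class p (\<lambda>k. if \<bar>k\<bar> \<le> int K then g k else 0)) < r / 2"
      unfolding c(2) by auto
    define d where "d = (\<lambda>k. if \<bar>k\<bar> \<le> int K then g k else 0)"
    define B where "B = Max ((\<lambda>k. norm (g k)) ` {- int K..int K})"
    have "norm (g k) \<le> B" if "\<bar>k\<bar> \<le> int K" for k
      unfolding B_def by (rule Max_ge) (use that in \<open>auto intro!: imageI\<close>)
    moreover from this[of 0] have "0 \<le> B" using norm_ge_zero[of "g 0"] by linarith
    ultimately have B: "norm (d k) \<le> B" for k by (simp add: d_def)
    have rp: "0 < (r / 2) powr p" using r by simp
    obtain L where L: "\<And>L'. L \<le> L' \<Longrightarrow> (LINT x|M. (if int L' \<le> \<bar>idx x\<bar> then B powr p else 0)) < (r / 2) powr p"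
      by (rule tail_integral_small[of "\<lambda>_. B powr p", OF _ rp]) auto
    \<comment> \<open>\<open>N \<ge> K\<close> puts the support inside the block, and
      \<open>N \<ge> L\<close> makes the tail small.\<close>
    define N where "N = max K L"
    \<comment> \<open>Adding \<open>N\<close> moves the block onto the residues from 0 to
      \<open>2 * N\<close>.\<close>
    define w where "w k = d ((k + int N) mod (2 * int N + 1) - int N)" for k
    have w: "w \<in> seq_Lp p" by (rule bounded_seq_Lp[OF p, of _ B]) (simp add: w_def B)
    have d: "d \<in> seq_Lp p" using K(1) by (simp add: d_def)
    have w_eq: "w k = d k" if "\<bar>k\<bar> \<le> int N" for k
    proof -
      have "(k + int N) mod (2 * int N + 1) = k + int N" using that by (intro mod_pos_pos_trivial) auto
      then show ?thesis by (simp add: w_def)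
    qed
    have "Lp_dist M p (seq_class p d) (seq_class p w) < r / 2"
    proof (rule dist_seq_class_lessI[OF p d w])
      show "integrable M (\<lambda>x. if int (Suc N) \<le> \<bar>idx x\<bar> then B powr p else 0)"
        by (rule tail_integrable) auto
      show "norm (d k - w k) powr p \<le> (if int (Suc N) \<le> \<bar>k\<bar> then B powr p else 0)" for k
      proof (cases "int (Suc N) \<le> \<bar>k\<bar>")
        case True
        then have "d k = 0" by (simp add: d_def N_def)
        then show ?thesis using True B p by (simp add: w_def powr_mono2)
      qed (simp add: w_eq)
      show "(LINT x|M. (if int (Suc N) \<le> \<bar>idx x\<bar> then B powr p else 0)) < (r / 2) powr p"
        by (rule L) (simp add: N_def)
    qed (use r in simp)
    moreover have "Lp_dist M p F (seq_class p w)
        \<le> Lp_dist M p F (seq_class p d) + Lp_dist M p (seq_class p d) (seq_class p w)"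
      using F d w by (intro L.triangle seq_class_in_Lp)
    ultimately have less: "Lp_dist M p F (seq_class p w) < r" using K(2) unfolding d_def by linarith
    have "(composition_operator M p f ^^ (2 * N + 1)) (seq_class p w) = seq_class p w"
    proof -
      have "w (k + int (2 * N + 1)) = w k" for k
      proof -
        have "k + int (2 * N + 1) + int N = k + int N + (2 * int N + 1)" by simp
        then show ?thesis unfolding w_def by (simp only: mod_add_self2)
      qed
      then show ?thesis using comp_op_power_seq_class(2)[OF w, of "2 * N + 1"] by (simp only:)
    qed
    then have "\<exists>n>0. (composition_operator M p f ^^ n) (seq_class p w) = seq_class p w"
      by (intro exI[of _ "2 * N + 1"] conjI) simp_all
    then have "seq_class p w \<in> ?P"
      using seq_class_in_Lp[OF w] by (simp only: periodic_points_def topspace_Lp[OF p] mem_Collect_eq simp_thms)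
    with less show ?thesis by blast
  qed
  moreover have "?P \<subseteq> Lp_space M p" by (auto simp: periodic_points_def topspace_Lp[OF p])
  ultimately have "\<forall>r>0. \<exists>G\<in>?P. G \<in> L.mball F r" if "F \<in> Lp_space M p" for F
    using that unfolding L.in_mball by blast
  then have "L.mtopology closure_of ?P = Lp_space M p"
    unfolding L.metric_closure_of by blast
  then show ?thesis unfolding topspace_Lp[OF p] by (simp only: Lp_topology_def)
qed

text \<open>
  Each \<open>b i\<close> is charged only to levels with \<open>\<bar>k\<bar> \<ge> G i\<close>, far enough out for the sum over \<open>i\<close>
  to be integrable.
\<close>

lemma integrable_majorant:
  fixes b :: "nat \<Rightarrow> real"
  assumes b: "\<And>i. 0 \<le> b i"
  obtains G :: "nat \<Rightarrow> nat" and h :: "int \<Rightarrow> real" where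
    "integrable M (\<lambda>x. h (idx x))" "\<And>k. 0 \<le> h k" "\<And>i k. int (G i) \<le> \<bar>k\<bar> \<Longrightarrow> b i \<le> h k"
proof -
  have "\<exists>G. i \<le> G \<and> (LINT x|M. (if int G \<le> \<bar>idx x\<bar> then b i else 0)) < (1/2) ^ i" for i
  proof -
    obtain L where "\<And>L'. L \<le> L' \<Longrightarrow> (LINT x|M. (if int L' \<le> \<bar>idx x\<bar> then b i else 0)) < (1/2) ^ i"
      by (rule tail_integral_small[of "\<lambda>_. b i" "(1/2) ^ i"]) auto
    then show ?thesis by (intro exI[of _ "max L i"]) simp
  qed
  then obtain G where G: "\<And>i. i \<le> G i" "\<And>i. (LINT x|M. (if int (G i) \<le> \<bar>idx x\<bar> then b i else 0)) < (1/2) ^ i"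
    by metis
  define t where "t i k = (if int (G i) \<le> \<bar>k\<bar> then b i else 0)" for i k
  \<comment> \<open>As \<open>i \<le> G i\<close>, only indices up to \<open>\<bar>k\<bar>\<close>
    matter at level \<open>k\<close>, so \<open>h\<close> is a finite sum; its integral is bounded
    by the geometric series.\<close>
  define h where "h k = (\<Sum>i\<le>nat \<bar>k\<bar>. t i k)" for k
  have t0: "0 \<le> t i k" for i k by (simp add: t_def b)
  have h0: "0 \<le> h k" for k unfolding h_def by (rule sum_nonneg) (rule t0)
  have le: "b i \<le> h k" if "int (G i) \<le> \<bar>k\<bar>" for i k
  proof -
    have "b i = t i k" using that by (simp add: t_def)
    also have "\<dots> \<le> h k" unfolding h_def
      by (rule member_le_sum) (use t0 that G(1)[of i] in auto)
    finally show ?thesis .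
  qed
  have nn: "(\<integral>\<^sup>+x. ennreal (t i (idx x)) \<partial>M) \<le> ennreal ((1/2) ^ i)" for i
  proof -
    have "integrable M (\<lambda>x. t i (idx x))"
      unfolding t_def using tail_integrable[of "\<lambda>_. b i"] b by simp
    then have "(\<integral>\<^sup>+x. ennreal (t i (idx x)) \<partial>M) = ennreal (LINT x|M. t i (idx x))"
      by (rule nn_integral_eq_integral) (simp add: t0)
    also have "\<dots> \<le> ennreal ((1/2) ^ i)" using G(2)[of i] by (intro ennreal_leI) (simp add: t_def)
    finally show ?thesis .
  qed
  have "(\<integral>\<^sup>+x. ennreal (h (idx x)) \<partial>M) \<le> (\<integral>\<^sup>+x. (\<Sum>i. ennreal (t i (idx x))) \<partial>M)"
  proof (rule nn_integral_mono)
    fix x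
    have "ennreal (h (idx x)) = (\<Sum>i\<le>nat \<bar>idx x\<bar>. ennreal (t i (idx x)))"
      by (simp add: h_def sum_ennreal t0)
    also have "\<dots> \<le> (\<Sum>i. ennreal (t i (idx x)))"
      by (intro sum_le_suminf) auto
    finally show "ennreal (h (idx x)) \<le> (\<Sum>i. ennreal (t i (idx x)))" .
  qed
  also have "\<dots> = (\<Sum>i. \<integral>\<^sup>+x. ennreal (t i (idx x)) \<partial>M)"
    by (rule nn_integral_suminf) (rule idx_comp_measurable[of "\<lambda>k. ennreal (t _ k)"])
  also have "\<dots> \<le> (\<Sum>i. ennreal ((1/2) ^ i))"
    by (intro suminf_le nn) auto
  also have "\<dots> = ennreal (\<Sum>i. (1/2) ^ i)"
    by (rule suminf_ennreal2) (auto intro: summable_geometric)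
  also have "\<dots> < \<infinity>" by simp
  finally have "integrable M (\<lambda>x. h (idx x))"
    using h0 by (intro integrableI_nonneg) auto
  with h0 le that show thesis by blast
qed

section \<open>Construction of a frequently hypercyclic vector\<close>

text \<open>The vector \<open>x\<close> carries a copy of \<open>y j\<close> around each position
  labelled \<open>j\<close>. Shifting by such a position brings that copy to the origin; the other
  copies are majorised by \<open>h\<close> outside the radius \<open>L j\<close>, where the tail of
  \<open>h\<close> is below \<open>(1/2) ^ j\<close>.\<close>

lemma imp_frequently_hypercyclic:
  assumes p: "1 \<le> p"
  shows "frequently_hypercyclic
    (Lp_topology M p :: ('a \<Rightarrow> 'k::{real_normed_field, banach, second_countable_topology}) set topology)
    (composition_operator M p f)"
proof -
  interpret L: Metric_space "Lp_space M p :: ('a \<Rightarrow> 'k) set set" "Lp_dist M p"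
    by (rule Lp_Metric_space[OF p])
  obtain D :: "'k set" where D: "countable D" "\<And>X. open X \<Longrightarrow> X \<noteq> {} \<Longrightarrow> \<exists>d\<in>D. d \<in> X"
    using countable_dense_setE by blast
  have D_dense: "\<exists>d\<in>D. norm (v - d) < e" if "0 < e" for v :: 'k and e
    using D(2)[of "ball v e"] that by (auto simp: dist_norm)
  then obtain d0 where "d0 \<in> D" using zero_less_one by blast
  define Y where "Y = (\<Union>K::nat. (\<lambda>g k. if \<bar>k\<bar> \<le> int K then g k else 0) ` (\<Pi>\<^sub>E k\<in>{- int K..int K}. D))"
  have Y_count: "countable Y"
    unfolding Y_def using D(1) by (intro countable_UN countable_image countable_PiE) auto
  have Y_mem: "(\<lambda>k. if \<bar>k\<bar> \<le> int K then g k else 0) \<in> Y" if "\<And>k. g k \<in> D" for K and g :: "int \<Rightarrow> 'k"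
  proof -
    have "(\<lambda>k. if \<bar>k\<bar> \<le> int K then g k else 0)
        = (\<lambda>k. if \<bar>k\<bar> \<le> int K then restrict g {- int K..int K} k else 0)"
      by (auto simp: fun_eq_iff)
    moreover have "restrict g {- int K..int K} \<in> (\<Pi>\<^sub>E k\<in>{- int K..int K}. D)" using that by auto
    ultimately show ?thesis unfolding Y_def by blast
  qed
  have Y_ne: "Y \<noteq> {}" using Y_mem[of "\<lambda>_. d0"] \<open>d0 \<in> D\<close> by blast
  define y where "y j = from_nat_into Y (fst (prod_decode j))" for j
  have y_Y: "y j \<in> Y" for j unfolding y_def by (rule from_nat_into[OF Y_ne])
  have "\<exists>s::nat. \<forall>k. y j k \<noteq> 0 \<longrightarrow> \<bar>k\<bar> < int s" for j
  proof -
    obtain K :: nat and g where "y j = (\<lambda>k. if \<bar>k\<bar> \<le> int K then g k else 0)"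
      using y_Y[of j] unfolding Y_def by blast
    then show ?thesis by (intro exI[of _ "Suc K"]) auto
  qed
  then obtain s :: "nat \<Rightarrow> nat" where s: "\<And>j k. y j k \<noteq> 0 \<Longrightarrow> \<bar>k\<bar> < int (s j)" by metis
  define b where "b j = (\<Sum>k\<in>{- int (s j)..int (s j)}. norm (y j k) powr p)" for j
  have b: "norm (y j k) powr p \<le> b j" for j k
  proof (cases "y j k = 0")
    case False
    then show ?thesis unfolding b_def using s[OF False] by (intro member_le_sum) auto
  qed (simp add: b_def sum_nonneg)
  have b0: "0 \<le> b j" for j unfolding b_def by (rule sum_nonneg) simp
  obtain G :: "nat \<Rightarrow> nat" and h :: "int \<Rightarrow> real"
    where h: "integrable M (\<lambda>x. h (idx x))" "\<And>k. 0 \<le> h k" and G: "\<And>i k. int (G i) \<le> \<bar>k\<bar> \<Longrightarrow> b i \<le> h k"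
    by (rule integrable_majorant[of b, OF b0]) (rule that)
  \<comment> \<open>The radius leaves room for the support of \<open>y j\<close> and, beyond it, for
    the distance \<open>G j\<close> from which \<open>h\<close> dominates its values.\<close>
  have "\<exists>L. s j + G j + 1 \<le> L \<and> (LINT x|M. (if int L \<le> \<bar>idx x\<bar> then h (idx x) else 0)) < (1/2) ^ j" for j
  proof -
    obtain L where "\<And>L'. L \<le> L' \<Longrightarrow> (LINT x|M. (if int L' \<le> \<bar>idx x\<bar> then h (idx x) else 0)) < (1/2) ^ j"
      by (rule tail_integral_small[OF h(1), of "(1/2) ^ j"]) auto
    then show ?thesis by (intro exI[of _ "max L (s j + G j + 1)"]) simp
  qed
  then obtain L where L: "\<And>j. s j + G j + 1 \<le> L j"
    "\<And>j. (LINT x|M. (if int (L j) \<le> \<bar>idx x\<bar> then h (idx x) else 0)) < (1/2) ^ j"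
    by metis
  have L1: "1 \<le> L j" for j using L(1)[of j] by simp
  obtain pos lab :: "nat \<Rightarrow> nat" where
    sep: "\<And>q q'. q < q' \<Longrightarrow> pos q + L (lab q) + L (lab q') \<le> pos q'" and
    start: "\<And>q. L (lab q) \<le> pos q" and
    dens: "\<And>j. \<exists>\<delta>>0. \<forall>\<^sub>F N in sequentially.
        \<delta> * real N \<le> card {n \<in> {1..N}. \<exists>q. n = pos q \<and> lab q = j}"
    by (rule marker_positions[of L, OF L1]) (rule that)
  have dist_pos: "int (L (lab q)) + int (L (lab q')) \<le> \<bar>int (pos q) - int (pos q')\<bar>" if "q \<noteq> q'" for q q'
    using sep[of q q'] sep[of q' q] that by (cases q q' rule: linorder_cases) auto
  define near where "near k q \<longleftrightarrow> \<bar>k - int (pos q)\<bar> < int (L (lab q))" for k q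
  have near_unique: "q = q'" if "near k q" "near k q'" for k q q'
    using that dist_pos[of q q'] unfolding near_def by (cases "q = q'") auto
  \<comment> \<open>At most one window contains \<open>k\<close> by \<open>near_unique\<close>, so
    the description is unambiguous.\<close>
  define x where "x k = (if \<exists>q. near k q then y (lab (THE q. near k q)) (k - int (pos (THE q. near k q))) else 0)" for k
  have x_near: "x k = y (lab q) (k - int (pos q))" if "near k q" for k q
  proof -
    have "(THE q. near k q) = q" using that near_unique by blast
    then show ?thesis using that unfolding x_def by auto
  qed
  have x_supp: "\<exists>q. \<bar>k - int (pos q)\<bar> < int (s (lab q)) \<and> norm (x k) powr p \<le> b (lab q)" if "x k \<noteq> 0" for k
  proof -
    have "\<exists>q. near k q" using that by (auto simp: x_def split: if_splits)
    then obtain q where q: "near k q" by blast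
    then show ?thesis using x_near[OF q] s that b by metis
  qed
  have x_h: "norm (x k) powr p \<le> h k" for k
  proof (cases "x k = 0")
    case False
    from x_supp[OF this] obtain q where q: "\<bar>k - int (pos q)\<bar> < int (s (lab q))" "norm (x k) powr p \<le> b (lab q)"
      by blast
    \<comment> \<open>\<open>start\<close> keeps even the first copy away from the origin, so
      \<open>h\<close> majorises all of \<open>x\<close>.\<close>
    have "int (G (lab q)) \<le> \<bar>k\<bar>" using q(1) start[of q] L(1)[of "lab q"] by linarith
    with G q(2) show ?thesis by (meson order_trans)
  qed (simp add: h(2))
  have x: "x \<in> seq_Lp p"
    unfolding seq_Lp_def using integrable_bounded_by[OF h(1), of "\<lambda>k. norm (x k) powr p"] x_h by simp
  \<comment> \<open>Inside the window the shifted vector equals \<open>y (lab q)\<close>. Outside, a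
    nonzero value belongs to another copy, labelled \<open>j\<close> say, whose support stays at
    distance at least \<open>G j\<close> from the new origin.\<close>
  have x_shift: "norm (x (k + int (pos q)) - y (lab q) k) powr p
      \<le> (if int (L (lab q)) \<le> \<bar>k\<bar> then h k else 0)" for q k
  proof (cases "int (L (lab q)) \<le> \<bar>k\<bar>")
    case False
    then have "near (k + int (pos q)) q" by (simp add: near_def)
    then have "x (k + int (pos q)) = y (lab q) k" using x_near by simp
    then show ?thesis using False by simp
  next
    case True
    have y0: "y (lab q) k = 0" using s[of "lab q" k] True L(1)[of "lab q"] by linarith
    have "norm (x (k + int (pos q))) powr p \<le> h k"
    proof (cases "x (k + int (pos q)) = 0")
      case False
      from x_supp[OF this] obtain q' where q': "\<bar>k + int (pos q) - int (pos q')\<bar> < int (s (lab q'))"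
        "norm (x (k + int (pos q))) powr p \<le> b (lab q')" by blast
      have "q' \<noteq> q" using q'(1) True L(1)[of "lab q"] by auto
      then have "int (G (lab q')) \<le> \<bar>k\<bar>" using dist_pos[of q' q] q'(1) L(1)[of "lab q'"] by linarith
      with G q'(2) show ?thesis by (meson order_trans)
    qed (simp add: h(2))
    then show ?thesis using True y0 by simp
  qed
  have y_Lp: "y j \<in> seq_Lp p" for j
  proof (rule finite_support_seq_Lp[of "{- int (s j)..int (s j)}"])
    show "y j k = 0" if "k \<notin> {- int (s j)..int (s j)}" for k using s[of j k] that by force
  qed simp
  have close: "Lp_dist M p ((composition_operator M p f ^^ pos q) (seq_class p x)) (seq_class p (y (lab q))) < r"
    if r: "0 < r" "(1/2) ^ lab q \<le> r powr p" for q r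
    unfolding comp_op_power_seq_class(2)[OF x]
  proof (rule dist_seq_class_lessI[OF p comp_op_power_seq_class(1)[OF x] y_Lp r(1) _ x_shift])
    show "integrable M (\<lambda>x. if int (L (lab q)) \<le> \<bar>idx x\<bar> then h (idx x) else 0)"
      by (rule tail_integrable[OF h])
    show "(LINT x|M. (if int (L (lab q)) \<le> \<bar>idx x\<bar> then h (idx x) else 0)) < r powr p"
      using L(2)[of "lab q"] r(2) by linarith
  qed
  have "\<exists>\<delta>>0. \<forall>\<^sub>F N in sequentially.
      \<delta> * real N \<le> card {n \<in> {1..N}. (composition_operator M p f ^^ n) (seq_class p x) \<in> U}"
    if U: "openin (Lp_topology M p) U" "U \<noteq> {}" for U :: "('a \<Rightarrow> 'k) set set"
  proof -
    have U': "U \<subseteq> Lp_space M p" "\<And>F. F \<in> U \<Longrightarrow> \<exists>r>0. L.mball F r \<subseteq> U"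
      using U(1) unfolding Lp_topology_def L.openin_mtopology by auto
    obtain F where "F \<in> U" using U(2) by blast
    with U' obtain r where F: "F \<in> Lp_space M p" and r: "0 < r" "L.mball F r \<subseteq> U" by blast
    obtain c where c: "c \<in> seq_Lp p" "F = seq_class p c" using Lp_space_seq[OF F] .
    have r2: "0 < r / 2" using r by simp
    obtain K :: nat and g where g: "\<And>k. g k \<in> D"
      "Lp_dist M p F (seq_class p (\<lambda>k. if \<bar>k\<bar> \<le> int K then g k else 0)) < r / 2"
      using finite_support_approx[OF p c(1) r2 D_dense] unfolding c(2) by metis
    from Y_mem[of g K, OF g(1)]
    obtain i where i: "from_nat_into Y i = (\<lambda>k. if \<bar>k\<bar> \<le> int K then g k else 0)"
      using from_nat_into_surj[OF Y_count] by blast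
    have "0 < (r / 2) powr p" using r2 by simp
    then obtain t where t: "(1/2) ^ t < (r / 2) powr p" using real_arch_pow_inv[of "(r / 2) powr p" "1/2"] by auto
    \<comment> \<open>The pairing satisfies \<open>j \<ge> t\<close>, so the accuracy
      \<open>(1/2) ^ j\<close> is fine enough.\<close>
    define j where "j = prod_encode (i, t)"
    have "(1/2::real) ^ j \<le> (1/2) ^ t"
      unfolding j_def by (rule power_decreasing) (auto simp: le_prod_encode_2)
    then have j: "(1/2) ^ j \<le> (r / 2) powr p" using t by linarith
    have yj: "Lp_dist M p F (seq_class p (y j)) < r / 2" using g(2) by (simp add: y_def j_def i)
    have visit: "(composition_operator M p f ^^ pos q) (seq_class p x) \<in> U" if "lab q = j" for q
    proof -
      let ?G = "(composition_operator M p f ^^ pos q) (seq_class p x)"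
      have G_in: "?G \<in> Lp_space M p"
        unfolding comp_op_power_seq_class(2)[OF x]
        by (rule seq_class_in_Lp[OF comp_op_power_seq_class(1)[OF x]])
      have "Lp_dist M p ?G (seq_class p (y j)) < r / 2" using close[OF r2, of q] j that by simp
      moreover have "Lp_dist M p F ?G \<le> Lp_dist M p F (seq_class p (y j)) + Lp_dist M p (seq_class p (y j)) ?G"
        by (rule L.triangle[OF F seq_class_in_Lp[OF y_Lp] G_in])
      ultimately have "Lp_dist M p F ?G < r" using yj by (simp add: L.commute)
      then have "?G \<in> L.mball F r" using F G_in by simp
      then show ?thesis using r(2) by blast
    qed
    obtain \<delta> where \<delta>: "0 < \<delta>" "\<forall>\<^sub>F N in sequentially.
        \<delta> * real N \<le> card {n \<in> {1..N}. \<exists>q. n = pos q \<and> lab q = j}" using dens by blast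
    have "\<forall>\<^sub>F N in sequentially.
        \<delta> * real N \<le> card {n \<in> {1..N}. (composition_operator M p f ^^ n) (seq_class p x) \<in> U}"
      using \<delta>(2)
    proof eventually_elim
      case (elim N)
      have "card {n \<in> {1..N}. \<exists>q. n = pos q \<and> lab q = j}
          \<le> card {n \<in> {1..N}. (composition_operator M p f ^^ n) (seq_class p x) \<in> U}"
        by (rule card_mono) (use visit in auto)
      then show ?case using elim by linarith
    qed
    then show ?thesis using \<delta>(1) by blast
  qed
  then show ?thesis
    unfolding frequently_hypercyclic_def liminf_density_pos_iff topspace_Lp[OF p]
    using seq_class_in_Lp[OF x] by blast
qed

end

section \<open>Equivalence of the three properties\<close>

theorem corollary3p9:
  fixes M :: "'a measure" and f :: "'a \<Rightarrow> 'a" and p :: real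
  assumes "measurable_system M f"
    and "dissipative M f"
    and "purely_atomic M"
    and "ergodic M f"
    and "p \<ge> 1"
  shows "(frequently_hypercyclic
            (Lp_topology M p ::
              ('a \<Rightarrow> 'k::{real_normed_field, banach, second_countable_topology}) set topology)
            (composition_operator M p f)
          \<longleftrightarrow> chaotic (Lp_topology M p :: ('a \<Rightarrow> 'k) set topology) (composition_operator M p f))
    \<and> (chaotic (Lp_topology M p :: ('a \<Rightarrow> 'k) set topology) (composition_operator M p f)
          \<longleftrightarrow> emeasure M (space M) < \<infinity>)"
proof -
  let ?H = "Lp_topology M p :: ('a \<Rightarrow> 'k) set topology"
  let ?T = "composition_operator M p f"
  obtain idx where "atomic_tower M f idx"
    using measurable_system.ergodic_dissipative_tower[OF assms(1,2,4)] by blast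
  then interpret atomic_tower M f idx .
  have "frequently_hypercyclic ?H ?T" "chaotic ?H ?T" if "emeasure M (space M) < \<infinity>"
  proof -
    interpret finite_tower M f idx by unfold_locales (rule that)
    show fhc: "frequently_hypercyclic ?H ?T" by (rule imp_frequently_hypercyclic[OF assms(5)])
    \<comment> \<open>Transitivity is inherited from the frequently hypercyclic vector.\<close>
    show "chaotic ?H ?T"
      unfolding chaotic_def
      using frequently_hypercyclic_imp_transitive[OF fhc] periodic_points_dense[OF assms(5)] by blast
  qed
  then show ?thesis
    using frequently_hypercyclic_imp_finite[OF assms(5)] chaotic_imp_finite[OF assms(5)] by blast
qed

end
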